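(* Let $\mathcal{G}=(A,X)\sim\mathrm{CSBM}(N,p,q,\mu_1,\mu_2,\sigma^2)$ with $\mu_1<\mu_2$, where $p,q=\omega(\log N/N)$ and $p>q>0$. Fix $K\in\mathbb{N}$ and $r>0$. There exists a constant $C=C(r,K)$ such that with probability at least $1-O(1/N^r)$, it holds for all $1\le k\le K$ that $$\left|\big(\mu_2^{(k)}-\mu_1^{(k)}\big)-\left(\frac{p-q}{p+q}\right)^k(\mu_2-\mu_1)\right|\le \frac{C}{\sqrt{N(p+q)}}.$$
   Context: $\mathrm{CSBM}(N,p,q,\mu_1,\mu_2,\sigma^2)$ (Contextual Stochastic Block Model): there are $N$ nodes in two classes $\mathcal{C}_1,\mathcal{C}_2$ of equal size. Any two nodes are joined by an edge independently, with probability $p$ if they are in the same class and probability $q$ if they are in different classes. $A\in\{0,1\}^{N\times N}$ is the adjacency matrix of the resulting undirected graph and $D=\mathrm{diag}(A\mathbf{1}_N)$ is its degree matrix, where $\mathbf{1}_N$ is the all-one vector. Each node $v\in\mathcal{C}_i$, $i\in\{1,2\}$, has an initial feature $X_v$ sampled independently from $\mathcal{N}(\mu_i,\sigma^2)$, with $\mu_i\in\mathbb{R}$ and $\sigma\in(0,\infty)$. The output of $k$ graph convolutions is $h^{(k)}=(D^{-1}A)^kX$. The representation of a node $v\in\mathcal{C}_i$ after $k$ graph convolutions is described as distributed as $\mathcal{N}(\mu_i^{(k)},(\sigma^{(k)})^2)$, so $\mu_i^{(k)}$ is the mean of the class-$i$ representations after $k$ graph convolutions. Concretely, with $\mu\in\mathbb{R}^N$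 given by $\mu_v=\mu_i$ for $v\in\mathcal{C}_i$, the difference of means is $$\mu_2^{(k)}-\mu_1^{(k)}=\frac{1}{N/2}\Big(\sum_{v\in\mathcal{C}_2}\big((D^{-1}A)^k\mu\big)_v-\sum_{v\in\mathcal{C}_1}\big((D^{-1}A)^k\mu\big)_v\Big).$$ The probability is over the random graph. *)

theory Defs
  imports
    "HOL-Probability.Probability"
    "HOL-Library.Landau_Symbols"
    "Jordan_Normal_Form.Matrix"
begin

unbundle no vec_syntax

text \<open>
  The nodes are \<open>0, \<dots>, N - 1\<close>, with \<open>N\<close> even. The two classes are taken to be the two halves
  of this range; the model is invariant under relabelling of the nodes.
\<close>

definition class1 :: "nat \<Rightarrow> nat set" where
  "class1 N = {..<N div 2}"

definition class2 :: "nat \<Rightarrow> nat set" where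
  "class2 N = {N div 2..<N}"

text \<open>A set of edges is given by its indicator \<open>E\<close> on the pairs \<open>(u, v)\<close> with \<open>u < v\<close>.\<close>

definition adjacency :: "nat \<Rightarrow> (nat \<times> nat \<Rightarrow> bool) \<Rightarrow> real mat" where
  "adjacency N E = Matrix.mat N N (\<lambda>(u, v). of_bool (u \<noteq> v \<and> E (min u v, max u v)))"

definition sbm :: "nat \<Rightarrow> real \<Rightarrow> real \<Rightarrow> real mat pmf" where
  "sbm N p q = map_pmf (adjacency N)
     (Pi_pmf {(u, v). u < v \<and> v < N} False
       (\<lambda>(u, v). bernoulli_pmf (if u \<in> class1 N \<longleftrightarrow> v \<in> class1 N then p else q)))"

definition node_mean :: "nat \<Rightarrow> real \<Rightarrow> real \<Rightarrow> nat \<Rightarrow> real" where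
  "node_mean N \<mu>1 \<mu>2 v = (if v \<in> class1 N then \<mu>1 else \<mu>2)"

definition csbm_features :: "nat \<Rightarrow> real \<Rightarrow> real \<Rightarrow> real \<Rightarrow> (nat \<Rightarrow> real) measure" where
  "csbm_features N \<mu>1 \<mu>2 \<sigma> =
     PiM {..<N} (\<lambda>v. density lborel (normal_density (node_mean N \<mu>1 \<mu>2 v) \<sigma>))"

text \<open>
  The last parameter is the standard deviation \<open>\<sigma>\<close>, not the variance \<open>\<sigma>\<^sup>2\<close>. Given the parameters,
  the graph and the features are independent.
\<close>

definition csbm ::
  "nat \<Rightarrow> real \<Rightarrow> real \<Rightarrow> real \<Rightarrow> real \<Rightarrow> real \<Rightarrow> (real mat \<times> (nat \<Rightarrow> real)) measure" where
  "csbm N p q \<mu>1 \<mu>2 \<sigma> = measure_pmf (sbm N p q) \<Otimes>\<^sub>M csbm_features N \<mu>1 \<mu>2 \<sigma>"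

definition node_degree :: "real mat \<Rightarrow> nat \<Rightarrow> real" where
  "node_degree A v = (A *\<^sub>v Matrix.vec (dim_col A) (\<lambda>_. 1)) $ v"

text \<open>
  The matrix \<open>D\<^sup>-\<^sup>1 A\<close>. Since \<open>inverse 0 = 0\<close>, the row of an isolated node is zero.
\<close>

definition conv_mat :: "real mat \<Rightarrow> real mat" where
  "conv_mat A = mat_diag (dim_row A) (\<lambda>v. inverse (node_degree A v)) * A"

definition graph_conv :: "real mat \<Rightarrow> nat \<Rightarrow> (nat \<Rightarrow> real) \<Rightarrow> real vec" where
  "graph_conv A k X = (conv_mat A ^\<^sub>m k) *\<^sub>v Matrix.vec (dim_row A) X"

text \<open>
  The mean \<open>\<mu>\<^sub>i\<^sup>(\<^sup>k\<^sup>)\<close> of the representations in the class \<open>C\<close> after \<open>k\<close> convolutions, for a fixed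
  graph; \<open>m v\<close> is the mean of the initial feature of node \<open>v\<close>. The lemma
  \<open>expectation_graph_conv\<close> below shows that \<open>graph_conv A k m\<close> is indeed the vector of means.
\<close>

definition class_mean :: "nat set \<Rightarrow> real mat \<Rightarrow> nat \<Rightarrow> (nat \<Rightarrow> real) \<Rightarrow> real" where
  "class_mean C A k m = 1 / (real (dim_row A) / 2) * (\<Sum>v\<in>C. graph_conv A k m $ v)"

lemma expectation_graph_conv:
  assumes A: "A \<in> carrier_mat N N" and v: "v < N" and \<sigma>: "\<sigma> > 0"
  shows "(\<integral>X. graph_conv A k X $ v \<partial>csbm_features N \<mu>1 \<mu>2 \<sigma>)
           = graph_conv A k (node_mean N \<mu>1 \<mu>2) $ v"
proof -
  define M where "M = (\<lambda>u. density lborel (\<lambda>x. ennreal (normal_density (node_mean N \<mu>1 \<mu>2 u) \<sigma> x)))"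
  have prob: "prob_space (M u)" for u
    unfolding M_def using \<sigma> by (rule prob_space_normal_density)
  have features: "csbm_features N \<mu>1 \<mu>2 \<sigma> = PiM {..<N} M"
    by (simp add: csbm_features_def M_def)
  have distr: "distr (PiM {..<N} M) (M u) (\<lambda>X. X u) = M u" if "u < N" for u
    using that prob by (intro distr_PiM_component) auto
  have sets_M: "sets (M u) = sets borel" for u
    by (simp add: M_def)
  have meas: "(\<lambda>X. X u) \<in> PiM {..<N} M \<rightarrow>\<^sub>M M u" if "u < N" for u
    using that by simp
  have int0: "integrable (M u) (\<lambda>x. x)" and mean0: "(\<integral>x. x \<partial>M u) = node_mean N \<mu>1 \<mu>2 u" for u
  proof -
    show "integrable (M u) (\<lambda>x. x)"
      unfolding M_def using integrable_normal_moment_nz_1[OF \<sigma>]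
      by (subst integrable_density) simp_all
    show "(\<integral>x. x \<partial>M u) = node_mean N \<mu>1 \<mu>2 u"
      unfolding M_def using integral_normal_moment_nz_1[OF \<sigma>]
      by (subst integral_density) simp_all
  qed
  have int: "integrable (PiM {..<N} M) (\<lambda>X. X u)"
    and mean: "(\<integral>X. X u \<partial>PiM {..<N} M) = node_mean N \<mu>1 \<mu>2 u" if "u < N" for u
    using int0[of u] mean0[of u] integrable_distr[OF meas[OF that], of "\<lambda>x. x"]
      integral_distr[OF meas[OF that], of "\<lambda>x. x"] distr[OF that] sets_M[of u]
      borel_measurable_integrable[OF int0[of u]]
    by auto
  have dim: "conv_mat A ^\<^sub>m k \<in> carrier_mat N N"
    unfolding conv_mat_def using A by (intro pow_carrier_mat mult_carrier_mat[OF _ A]) simp_all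
  have mult: "(B *\<^sub>v Matrix.vec N X) $ v = (\<Sum>u<N. B $$ (v, u) * X u)"
    if "B \<in> carrier_mat N N" for B :: "real mat" and X
    using that v by (auto simp: scalar_prod_def atLeast0LessThan intro!: sum.cong)
  have conv: "graph_conv A k X $ v = (\<Sum>u<N. (conv_mat A ^\<^sub>m k) $$ (v, u) * X u)" for X
    unfolding graph_conv_def carrier_matD(1)[OF A] by (rule mult[OF dim])
  show ?thesis
    unfolding conv features
    by (subst Bochner_Integration.integral_sum) (auto simp: int mean)
qed

end

theory Submission
  imports Defs "HOL-Real_Asymp.Real_Asymp"
begin

text \<open>
  Write \<open>P = D\<^sup>-\<^sup>1 A\<close>, let \<open>s\<close> be the \<open>\<plusminus>1\<close> vector of the classes, \<open>\<lambda> = (p - q) / (p + q)\<close> and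
  \<open>d = N (p + q) / 2\<close>. The difference of means is \<open>(\<mu>2 - \<mu>1) / N * s\<^sup>T P\<^sup>k s\<close>, so the
  question is how far \<open>s\<^sup>T P\<^sup>k s / N\<close> is from \<open>\<lambda>\<^sup>k\<close>.

  Let \<open>x = P s - \<lambda> s\<close>. For the inner product weighted by degrees, \<open>P\<close> is a self-adjoint
  contraction, and \<open>d s\<^sup>T P\<^sup>j x = \<langle>s + f, P\<^sup>j x\<rangle> = \<langle>P\<^sup>j s, x\<rangle> + \<langle>f, P\<^sup>j x\<rangle>\<close> with
  \<open>f\<^sub>v = s\<^sub>v (d / d\<^sub>v - 1)\<close>. Expanding \<open>P\<^sup>j s\<close> around \<open>\<lambda>\<^sup>j s\<close> leaves the term \<open>\<langle>s, x\<rangle>\<close>, which is linear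
  in the edges, and terms of second order in \<open>x\<close> and \<open>f\<close>. So the error is of order
  \<open>1 / d\<close> up to the fluctuation of \<open>\<langle>s, x\<rangle>\<close>, which is \<open>o(1 / \<surd>d)\<close>. This is why \<open>C\<close> can be chosen
  independently of \<open>\<mu>2 - \<mu>1\<close>: it may even be \<open>1\<close>.

  What has to be bounded with high probability are the squared norms of \<open>x\<close> and \<open>f\<close>, without a
  logarithmic loss. The entries become independent once each row is cut at the
  diagonal; a Chernoff bound truncates them, and then Hoeffding's inequality applies to their squares.
\<close>

subsection \<open>Walks on weighted graphs\<close>

text \<open>Each step adds an error of at most \<open>B\<close>, and multiplication by
  \<open>lam\<close> cannot enlarge the errors already present, so they add up linearly. This serves
  twice below: for the main quantity and for a correlation inside its error term.\<close>

lemma perturbed_recurrence: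
  fixes t e :: "nat \<Rightarrow> real"
  assumes rec: "\<And>j. j < k \<Longrightarrow> t (Suc j) = lam * t j + e j"
    and err: "\<And>j. j < k \<Longrightarrow> \<bar>e j\<bar> \<le> B" and lam: "\<bar>lam\<bar> \<le> 1"
  shows "\<bar>t k - lam ^ k * t 0\<bar> \<le> real k * B"
  using rec err
proof (induction k)
  case (Suc k)
  have IH: "\<bar>t k - lam ^ k * t 0\<bar> \<le> real k * B"
    using Suc by simp
  have "t (Suc k) - lam ^ Suc k * t 0 = lam * (t k - lam ^ k * t 0) + e k"
    using Suc.prems(1)[of k] by (simp add: algebra_simps)
  also have "\<bar>\<dots>\<bar> \<le> \<bar>lam\<bar> * \<bar>t k - lam ^ k * t 0\<bar> + \<bar>e k\<bar>"
    by (metis abs_mult abs_triangle_ineq)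
  also have "\<dots> \<le> 1 * (real k * B) + B"
    using IH Suc.prems(2)[of k] lam by (intro add_mono mult_mono) auto
  finally show ?case
    by (simp add: algebra_simps)
qed simp

section \<open>The walk operator and its degree-weighted inner product\<close>

definition weighted_degree :: "nat \<Rightarrow> (nat \<Rightarrow> nat \<Rightarrow> real) \<Rightarrow> nat \<Rightarrow> real" where
  "weighted_degree n a v = (\<Sum>w<n. a v w)"

text \<open>This is D^{-1} A as an operator on functions, so that its powers are iterates under
  \<open>^^\<close>. Division by zero gives zero, in agreement with the zero row of an isolated node
  in \<open>conv_mat\<close>.\<close>

definition walk :: "nat \<Rightarrow> (nat \<Rightarrow> nat \<Rightarrow> real) \<Rightarrow> (nat \<Rightarrow> real) \<Rightarrow> nat \<Rightarrow> real" where
  "walk n a x v = (\<Sum>w<n. a v w * x w) / weighted_degree n a v"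

lemma walk_linear:
  "walk n a (\<lambda>v. \<alpha> * x v + \<beta> * y v) = (\<lambda>v. \<alpha> * walk n a x v + \<beta> * walk n a y v)"
  by (auto simp: walk_def fun_eq_iff sum.distrib sum_distrib_left algebra_simps add_divide_distrib
      intro!: sum.cong)

lemma walk_pow_linear:
  "(walk n a ^^ k) (\<lambda>v. \<alpha> * x v + \<beta> * y v)
     = (\<lambda>v. \<alpha> * (walk n a ^^ k) x v + \<beta> * (walk n a ^^ k) y v)"
  by (induction k) (simp_all add: walk_linear)

locale weighted_graph =
  fixes n :: nat and a :: "nat \<Rightarrow> nat \<Rightarrow> real"
  assumes sym: "v < n \<Longrightarrow> w < n \<Longrightarrow> a v w = a w v"
    and nonneg: "v < n \<Longrightarrow> w < n \<Longrightarrow> a v w \<ge> 0"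
    and weighted_degree_pos: "v < n \<Longrightarrow> weighted_degree n a v > 0"
begin

abbreviation "d \<equiv> weighted_degree n a"
abbreviation "P \<equiv> walk n a"

definition deg_inner :: "(nat \<Rightarrow> real) \<Rightarrow> (nat \<Rightarrow> real) \<Rightarrow> real" where
  "deg_inner x y = (\<Sum>v<n. d v * x v * y v)"

lemma deg_inner_commute: "deg_inner x y = deg_inner y x"
  by (simp add: deg_inner_def mult_ac)

text \<open>The degree weight cancels the normalisation in \<open>P\<close> and leaves the bilinear
  form of \<open>a\<close>, whose symmetry then makes \<open>P\<close> self-adjoint.\<close>

lemma deg_inner_walk: "deg_inner (P x) y = (\<Sum>v<n. \<Sum>w<n. a v w * x w * y v)"
  unfolding deg_inner_def
proof (rule sum.cong[OF refl])
  fix v assume "v \<in> {..<n}"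
  then have "d v \<noteq> 0" using weighted_degree_pos[of v] by simp
  then show "d v * P x v * y v = (\<Sum>w<n. a v w * x w * y v)"
    by (simp add: walk_def sum_distrib_right)
qed

lemma deg_inner_walk_adjoint: "deg_inner (P x) y = deg_inner x (P y)"
proof -
  have "deg_inner (P x) y = (\<Sum>w<n. \<Sum>v<n. a v w * x w * y v)"
    unfolding deg_inner_walk by (rule sum.swap)
  also have "\<dots> = (\<Sum>w<n. \<Sum>v<n. a w v * y v * x w)"
    by (intro sum.cong refl) (simp add: sym mult_ac)
  also have "\<dots> = deg_inner (P y) x"
    by (simp add: deg_inner_walk)
  finally show ?thesis by (simp add: deg_inner_commute)
qed

lemma deg_inner_walk_pow_adjoint: "deg_inner ((P ^^ k) x) y = deg_inner x ((P ^^ k) y)"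
proof (induction k arbitrary: x)
  case (Suc k)
  have "deg_inner ((P ^^ Suc k) x) y = deg_inner (P x) ((P ^^ k) y)"
    unfolding funpow_Suc_right o_def by (rule Suc.IH)
  then show ?case by (simp add: deg_inner_walk_adjoint)
qed simp

text \<open>The inequality |xy| <= (x^2 + y^2) / 2 takes the place of Cauchy-Schwarz, since both
  arguments are bounded by the same \<open>M\<close>.\<close>

lemma abs_deg_inner_le:
  assumes "deg_inner x x \<le> M" "deg_inner y y \<le> M"
  shows "\<bar>deg_inner x y\<bar> \<le> M"
proof -
  have "\<bar>deg_inner x y\<bar> \<le> (\<Sum>v<n. \<bar>d v * x v * y v\<bar>)"
    unfolding deg_inner_def by (rule sum_abs)
  also have "\<dots> \<le> (\<Sum>v<n. (d v * x v * x v + d v * y v * y v) / 2)"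
  proof (rule sum_mono)
    fix v assume "v \<in> {..<n}"
    then have d: "d v > 0" using weighted_degree_pos[of v] by simp
    have "0 \<le> (\<bar>x v\<bar> - \<bar>y v\<bar>)\<^sup>2" by simp
    then have "\<bar>x v\<bar> * \<bar>y v\<bar> \<le> (x v * x v + y v * y v) / 2"
      by (simp add: power2_diff flip: power2_eq_square)
    from mult_left_mono[OF this, of "d v"] d
    show "\<bar>d v * x v * y v\<bar> \<le> (d v * x v * x v + d v * y v * y v) / 2"
      by (simp add: abs_mult algebra_simps)
  qed
  also have "\<dots> = (deg_inner x x + deg_inner y y) / 2"
    by (simp add: deg_inner_def sum.distrib sum_divide_distrib add_divide_distrib)
  finally show ?thesis using assms by simp
qed

text \<open>\<open>P x v\<close> is an average of \<open>x\<close> over the neighbours of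
  \<open>v\<close>, so its square is at most the average of the squares. After summation over
  \<open>v\<close>, symmetry turns the column sums of \<open>a\<close> back into degrees.\<close>

lemma deg_inner_walk_le: "deg_inner (P x) (P x) \<le> deg_inner x x"
proof -
  have "deg_inner (P x) (P x) \<le> (\<Sum>v<n. \<Sum>w<n. a v w * (x w)\<^sup>2)"
    unfolding deg_inner_def
  proof (rule sum_mono)
    fix v assume v: "v \<in> {..<n}"
    then have d: "d v > 0" using weighted_degree_pos[of v] by simp
    \<comment> \<open>Nonnegativity of the weighted variance of \<open>x\<close> around its mean
      \<open>P x v\<close>.\<close>
    have "0 \<le> (\<Sum>w<n. a v w * (x w - P x v)\<^sup>2)"
      using v by (intro sum_nonneg mult_nonneg_nonneg nonneg) auto
    also have "\<dots> = (\<Sum>w<n. a v w * (x w)\<^sup>2) - 2 * P x v * (\<Sum>w<n. a v w * x w) + (P x v)\<^sup>2 * d v"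
      by (simp add: weighted_degree_def power2_diff algebra_simps sum.distrib sum_subtractf sum_distrib_left
          sum_distrib_right)
    also have "(\<Sum>w<n. a v w * x w) = d v * P x v"
      using d by (simp add: walk_def)
    finally show "d v * P x v * P x v \<le> (\<Sum>w<n. a v w * (x w)\<^sup>2)"
      by (simp add: algebra_simps power2_eq_square)
  qed
  also have "\<dots> = (\<Sum>w<n. \<Sum>v<n. a v w * (x w)\<^sup>2)"
    by (rule sum.swap)
  also have "\<dots> = deg_inner x x"
    unfolding deg_inner_def weighted_degree_def sum_distrib_right
    by (intro sum.cong refl) (simp add: sym power2_eq_square)
  finally show ?thesis .
qed

lemma deg_inner_walk_pow_le: "deg_inner ((P ^^ k) x) ((P ^^ k) x) \<le> deg_inner x x"
proof (induction k)
  case (Suc k)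
  then show ?case using deg_inner_walk_le[of "(P ^^ k) x"] by simp
qed simp

text \<open>If \<open>x\<close> and \<open>f\<close> vanished, \<open>s\<close> would be an
  eigenvector and all degrees would equal \<open>D\<close>. In general, inner products of two small
  vectors stay below \<open>M\<close> under all powers of the contraction \<open>P\<close>, and only
  the first-order term \<open>deg_inner s x\<close> needs a bound \<open>R\<close> of its
  own.\<close>

lemma walk_pow_approx_eigenvector:
  fixes s :: "nat \<Rightarrow> real" and lam D M R :: real
  assumes s: "\<And>v. v < n \<Longrightarrow> s v * s v = 1" and lam: "\<bar>lam\<bar> \<le> 1" and D: "D > 0" and M: "M \<ge> 0"
  defines "x \<equiv> \<lambda>v. P s v - lam * s v"
    and "f \<equiv> \<lambda>v. (D / d v - 1) * s v"
  assumes xx: "deg_inner x x \<le> M" and ff: "deg_inner f f \<le> M" and sx: "\<bar>deg_inner s x\<bar> \<le> R"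
  shows "\<bar>(\<Sum>v<n. s v * (P ^^ k) s v) - lam ^ k * real n\<bar> \<le> real k * ((R + real k * M) / D)"
proof -
  have Ps: "P s = (\<lambda>v. lam * s v + 1 * x v)"
    by (simp add: x_def)
  have rec: "(P ^^ Suc j) s = (\<lambda>v. lam * (P ^^ j) s v + 1 * (P ^^ j) x v)" for j
    unfolding funpow_Suc_right o_def by (subst Ps) (rule walk_pow_linear)
  have bd: "\<bar>deg_inner ((P ^^ j) x) y\<bar> \<le> M" if "deg_inner y y \<le> M" for j y
    using abs_deg_inner_le[OF order_trans[OF deg_inner_walk_pow_le xx] that] .
  \<comment> \<open>The powers of \<open>P\<close> on \<open>s\<close> are expanded step by step:
    the initial value contributes \<open>R\<close>, and each step adds the second-order term
    \<open>deg_inner ((P ^^ j) x) x\<close>.\<close>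
  have corr: "\<bar>deg_inner ((P ^^ j) s) x\<bar> \<le> R + real j * M" for j
  proof -
    have "\<bar>deg_inner ((P ^^ j) s) x - lam ^ j * deg_inner ((P ^^ 0) s) x\<bar> \<le> real j * M"
    proof (rule perturbed_recurrence[where e = "\<lambda>j. deg_inner ((P ^^ j) x) x"])
      show "deg_inner ((P ^^ Suc j) s) x = lam * deg_inner ((P ^^ j) s) x + deg_inner ((P ^^ j) x) x" for j
        unfolding rec deg_inner_def by (simp add: sum.distrib sum_distrib_left algebra_simps)
    qed (use bd[OF xx] lam in auto)
    moreover have "\<bar>lam ^ j * deg_inner s x\<bar> \<le> R"
    proof -
      have "\<bar>lam ^ j * deg_inner s x\<bar> \<le> 1 * R"
        unfolding abs_mult power_abs using lam sx by (intro mult_mono power_le_one) auto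
      then show ?thesis by simp
    qed
    ultimately show ?thesis by simp
  qed
  have "\<bar>(\<Sum>v<n. s v * (P ^^ k) s v) - lam ^ k * (\<Sum>v<n. s v * (P ^^ 0) s v)\<bar>
          \<le> real k * ((R + real k * M) / D)"
  proof (rule perturbed_recurrence[where e = "\<lambda>j. \<Sum>v<n. s v * (P ^^ j) x v"])
    show "(\<Sum>v<n. s v * (P ^^ Suc j) s v)
            = lam * (\<Sum>v<n. s v * (P ^^ j) s v) + (\<Sum>v<n. s v * (P ^^ j) x v)" for j
      unfolding rec by (simp add: sum.distrib sum_distrib_left algebra_simps)
    fix j assume j: "j < k"
    \<comment> \<open>Writing \<open>D = d v * (1 + (D / d v - 1))\<close> trades the unweighted
      product with \<open>s\<close> for the weighted product with \<open>s + f\<close>.\<close>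
    have split: "D * (\<Sum>v<n. s v * (P ^^ j) x v) = deg_inner s ((P ^^ j) x) + deg_inner f ((P ^^ j) x)"
      unfolding deg_inner_def f_def sum_distrib_left sum.distrib[symmetric]
    proof (rule sum.cong[OF refl])
      fix v assume "v \<in> {..<n}"
      then have "d v \<noteq> 0" using weighted_degree_pos[of v] by simp
      then show "D * (s v * (P ^^ j) x v)
        = d v * s v * (P ^^ j) x v + d v * ((D / d v - 1) * s v) * (P ^^ j) x v"
        by (simp add: field_simps)
    qed
    \<comment> \<open>Self-adjointness moves the power from \<open>x\<close> to \<open>s\<close> in
      the first term, where \<open>corr\<close> applies; the second term pairs two small
      vectors.\<close>
    have "\<bar>D * (\<Sum>v<n. s v * (P ^^ j) x v)\<bar> \<le> \<bar>deg_inner ((P ^^ j) s) x\<bar> + \<bar>deg_inner ((P ^^ j) x) f\<bar>"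
      unfolding split deg_inner_walk_pow_adjoint[of j s] deg_inner_commute[of f] by (rule abs_triangle_ineq)
    also have "\<dots> \<le> (R + real j * M) + M"
      using corr[of j] bd[OF ff, of j] by linarith
    also have "\<dots> \<le> R + real k * M"
    proof -
      have "(real j + 1) * M \<le> real k * M"
        using j M by (intro mult_right_mono) auto
      then show ?thesis by (simp add: distrib_right)
    qed
    finally show "\<bar>\<Sum>v<n. s v * (P ^^ j) x v\<bar> \<le> (R + real k * M) / D"
      using D by (simp add: abs_mult pos_le_divide_eq mult.commute)
  qed (rule lam)
  moreover have "(\<Sum>v<n. s v * (P ^^ 0) s v) = real n"
    by (simp add: s)
  ultimately show ?thesis by simp
qed

end

subsection \<open>Sums of independent Bernoulli variables\<close>

lemma exp_le_quadratic:
  fixes x :: real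
  assumes "\<bar>x\<bar> \<le> 1"
  shows "exp x \<le> 1 + x + x\<^sup>2"
proof (cases "x \<ge> 0")
  case True
  then show ?thesis using exp_bound[of x] assms by simp
next
  case False
  then have "exp x * (1 - x) \<le> exp x * exp (- x)"
    using exp_ge_add_one_self[of "- x"] by (intro mult_left_mono) auto
  also have "\<dots> = 1" by (simp flip: exp_add)
  \<comment> \<open>The product is 1 - x^3, which is at least 1 for negative
    \<open>x\<close>.\<close>
  also have "1 \<le> (1 + x + x\<^sup>2) * (1 - x)"
    using False mult_nonneg_nonneg[of "x\<^sup>2" "- x"] by (simp add: algebra_simps power2_eq_square)
  finally show ?thesis using False by (simp add: mult_le_cancel_right)
qed

text \<open>The exponent is proportional to \<open>p\<close>, unlike in Hoeffding's lemma. In a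
  sparse graph this keeps the variance proxy of a row at the order of the expected degree.\<close>

lemma bernoulli_mgf_centered:
  fixes x p :: real
  assumes x: "\<bar>x\<bar> \<le> 1" and p: "0 \<le> p" "p \<le> 1"
  shows "measure_pmf.expectation (bernoulli_pmf p) (\<lambda>b. exp (x * (of_bool b - p))) \<le> exp (p * x\<^sup>2)"
proof -
  have "measure_pmf.expectation (bernoulli_pmf p) (\<lambda>b. exp (x * (of_bool b - p)))
      = exp (- x * p) * (1 + p * (exp x - 1))"
    using p by (simp add: integral_bernoulli_pmf algebra_simps exp_diff exp_minus field_simps flip: exp_add)
  also have "\<dots> \<le> exp (- x * p) * exp (p * (exp x - 1))"
    by (intro mult_left_mono exp_ge_add_one_self) auto
  also have "\<dots> = exp (p * (exp x - 1 - x))"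
    by (simp add: algebra_simps flip: exp_add)
  also have "\<dots> \<le> exp (p * x\<^sup>2)"
    using exp_le_quadratic[OF x] p by (simp add: mult_left_mono)
  finally show ?thesis .
qed

lemma bernoulli_sum_mgf:
  fixes c P :: "'a \<Rightarrow> real" and \<theta> V :: real
  assumes I: "finite I" and F: "F \<subseteq> I" and P: "\<And>e. e \<in> I \<Longrightarrow> 0 \<le> P e \<and> P e \<le> 1"
    and c: "\<And>e. e \<in> F \<Longrightarrow> \<bar>c e\<bar> \<le> 2" and V: "(\<Sum>e\<in>F. P e) \<le> V" and \<theta>: "2 * \<bar>\<theta>\<bar> \<le> 1"
  defines "X \<equiv> \<lambda>\<omega>. \<Sum>e\<in>F. c e * (of_bool (\<omega> e) - P e)"
  shows "measure_pmf.expectation (Pi_pmf I False (\<lambda>e. bernoulli_pmf (P e))) (\<lambda>\<omega>. exp (\<theta> * X \<omega>))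
          \<le> exp (4 * \<theta>\<^sup>2 * V)"
proof -
  \<comment> \<open>The factor 1 outside \<open>F\<close> lets the product run over all of
    \<open>I\<close>, the index set of the product distribution.\<close>
  define g where "g = (\<lambda>e b. if e \<in> F then exp (\<theta> * c e * (of_bool b - P e)) else 1)"
  have fin: "finite F" using I F by (rule finite_subset[rotated])
  have "exp (\<theta> * X \<omega>) = (\<Prod>e\<in>I. g e (\<omega> e))" for \<omega>
  proof -
    have "exp (\<theta> * X \<omega>) = (\<Prod>e\<in>F. exp (\<theta> * c e * (of_bool (\<omega> e) - P e)))"
      unfolding X_def sum_distrib_left exp_sum[OF fin] by (simp add: mult_ac)
    also have "\<dots> = (\<Prod>e\<in>I. g e (\<omega> e))"
      using F I unfolding g_def by (intro prod.mono_neutral_cong_left) auto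
    finally show ?thesis .
  qed
  then have "measure_pmf.expectation (Pi_pmf I False (\<lambda>e. bernoulli_pmf (P e))) (\<lambda>\<omega>. exp (\<theta> * X \<omega>))
      = (\<Prod>e\<in>I. measure_pmf.expectation (bernoulli_pmf (P e)) (g e))"
    by (simp, subst expectation_prod_Pi_pmf[OF I])
       (auto simp: g_def intro!: integrable_measure_pmf_finite)
  also have "\<dots> \<le> (\<Prod>e\<in>I. if e \<in> F then exp (P e * (\<theta> * c e)\<^sup>2) else 1)"
  proof (intro prod_mono conjI)
    fix e assume e: "e \<in> I"
    show "0 \<le> measure_pmf.expectation (bernoulli_pmf (P e)) (g e)"
      by (intro Bochner_Integration.integral_nonneg) (simp add: g_def)
    show "measure_pmf.expectation (bernoulli_pmf (P e)) (g e)
            \<le> (if e \<in> F then exp (P e * (\<theta> * c e)\<^sup>2) else 1)"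
    proof (cases "e \<in> F")
      case True
      have "\<bar>\<theta> * c e\<bar> \<le> \<bar>\<theta>\<bar> * 2"
        unfolding abs_mult using c[OF True] by (intro mult_left_mono) auto
      then show ?thesis
        using bernoulli_mgf_centered[of "\<theta> * c e" "P e"] P[OF e] \<theta> True by (simp add: g_def)
    qed (simp add: g_def)
  qed
  also have "\<dots> = (\<Prod>e\<in>F. exp (P e * (\<theta> * c e)\<^sup>2))"
    using F I by (intro prod.mono_neutral_cong_right) auto
  also have "\<dots> = exp (\<Sum>e\<in>F. P e * (\<theta> * c e)\<^sup>2)"
    by (simp add: exp_sum fin)
  also have "(\<Sum>e\<in>F. P e * (\<theta> * c e)\<^sup>2) \<le> (\<Sum>e\<in>F. P e * (4 * \<theta>\<^sup>2))"
  proof (intro sum_mono mult_left_mono)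
    fix e assume e: "e \<in> F"
    have "\<bar>c e\<bar>\<^sup>2 \<le> 2\<^sup>2" using c[OF e] by (intro power_mono) auto
    then show "(\<theta> * c e)\<^sup>2 \<le> 4 * \<theta>\<^sup>2"
      using mult_left_mono[of "(c e)\<^sup>2" 4 "\<theta>\<^sup>2"] by (simp add: power_mult_distrib mult.commute)
    show "0 \<le> P e" using P e F by auto
  qed
  also have "\<dots> \<le> 4 * \<theta>\<^sup>2 * V"
    using mult_left_mono[OF V, of "4 * \<theta>\<^sup>2"] by (simp add: sum_distrib_right[symmetric] mult_ac)
  finally show ?thesis by simp
qed

lemma bernoulli_sum_tail:
  fixes c P :: "'a \<Rightarrow> real" and T V :: real
  assumes I: "finite I" and F: "F \<subseteq> I" and P: "\<And>e. e \<in> I \<Longrightarrow> 0 \<le> P e \<and> P e \<le> 1"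
    and c: "\<And>e. e \<in> F \<Longrightarrow> \<bar>c e\<bar> \<le> 2" and V: "(\<Sum>e\<in>F. P e) \<le> V" "V > 0"
    and T: "0 \<le> T" "T \<le> 4 * V"
  defines "X \<equiv> \<lambda>\<omega>. \<Sum>e\<in>F. c e * (of_bool (\<omega> e) - P e)"
  shows "measure_pmf.prob (Pi_pmf I False (\<lambda>e. bernoulli_pmf (P e))) {\<omega>. \<bar>X \<omega>\<bar> \<ge> T}
          \<le> 2 * exp (- (T\<^sup>2 / (16 * V)))"
proof -
  let ?M = "Pi_pmf I False (\<lambda>e. bernoulli_pmf (P e))"
  \<comment> \<open>The minimiser of the Chernoff exponent - \<theta> T + 4 \<theta>^2 V; the bound
    \<open>T \<le> 4 * V\<close> keeps it in the range of \<open>bernoulli_sum_mgf\<close>.\<close>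
  define \<theta> where "\<theta> = T / (8 * V)"
  have \<theta>: "\<theta> \<ge> 0" "2 * \<theta> \<le> 1"
    using T V(2) by (simp_all add: \<theta>_def divide_le_eq)
  have \<theta>T: "\<theta> * T = 2 * (T\<^sup>2 / (16 * V))" and \<theta>V: "4 * \<theta>\<^sup>2 * V = T\<^sup>2 / (16 * V)"
    using V(2) by (simp_all add: \<theta>_def power2_eq_square)
  have fin: "finite (set_pmf ?M)"
    by (rule finite_subset[OF set_Pi_pmf_subset'[OF I]]) (use I in auto)
  have one: "measure_pmf.prob ?M {\<omega>. T \<le> \<epsilon> * X \<omega>} \<le> exp (- (T\<^sup>2 / (16 * V)))"
    if \<epsilon>: "\<epsilon> = 1 \<or> \<epsilon> = -1" for \<epsilon>
  proof -
    have "measure_pmf.prob ?M {\<omega>. T \<le> \<epsilon> * X \<omega>}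
        = measure_pmf.expectation ?M (indicator {\<omega>. T \<le> \<epsilon> * X \<omega>})"
      by simp
    also have "\<dots> \<le> measure_pmf.expectation ?M (\<lambda>\<omega>. exp (- \<theta> * T) * exp ((\<epsilon> * \<theta>) * X \<omega>))"
    proof (intro integral_mono integrable_measure_pmf_finite fin)
      fix \<omega>
      have "0 \<le> \<theta> * (\<epsilon> * X \<omega> - T)" if "T \<le> \<epsilon> * X \<omega>"
        using that \<theta>(1) by simp
      then show "indicator {\<omega>. T \<le> \<epsilon> * X \<omega>} \<omega> \<le> exp (- \<theta> * T) * exp ((\<epsilon> * \<theta>) * X \<omega>)"
        by (auto simp: indicator_def algebra_simps simp flip: exp_add)
    qed
    also have "\<dots> = exp (- \<theta> * T) * measure_pmf.expectation ?M (\<lambda>\<omega>. exp ((\<epsilon> * \<theta>) * X \<omega>))"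
      by simp
    also have "\<dots> \<le> exp (- \<theta> * T) * exp (4 * (\<epsilon> * \<theta>)\<^sup>2 * V)"
      unfolding X_def using \<theta> \<epsilon>
      by (intro mult_left_mono bernoulli_sum_mgf I F P c V(1)) auto
    also have "(\<epsilon> * \<theta>)\<^sup>2 = \<theta>\<^sup>2"
      using \<epsilon> by auto
    also have "exp (- \<theta> * T) * exp (4 * \<theta>\<^sup>2 * V) = exp (- (T\<^sup>2 / (16 * V)))"
      unfolding exp_add[symmetric] \<theta>V using \<theta>T by simp
    finally show ?thesis .
  qed
  have "{\<omega>. \<bar>X \<omega>\<bar> \<ge> T} = {\<omega>. T \<le> 1 * X \<omega>} \<union> {\<omega>. T \<le> (-1) * X \<omega>}"
    by auto
  then have "measure_pmf.prob ?M {\<omega>. \<bar>X \<omega>\<bar> \<ge> T}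
      \<le> measure_pmf.prob ?M {\<omega>. T \<le> 1 * X \<omega>} + measure_pmf.prob ?M {\<omega>. T \<le> (-1) * X \<omega>}"
    by (simp only: measure_Un_le sets_measure_pmf UNIV_I)
  then show ?thesis using one[of 1] one[of "-1"] by linarith
qed

text \<open>The exponential moments at plus and minus \<open>1 / sqrt V\<close> dominate the square,
  which gives the order \<open>V\<close> without computing a variance. The bound
  \<open>V \<ge> 4\<close> makes these parameters admissible.\<close>

lemma bernoulli_sum_second_moment:
  fixes c P :: "'a \<Rightarrow> real" and V :: real
  assumes I: "finite I" and F: "F \<subseteq> I" and P: "\<And>e. e \<in> I \<Longrightarrow> 0 \<le> P e \<and> P e \<le> 1"
    and c: "\<And>e. e \<in> F \<Longrightarrow> \<bar>c e\<bar> \<le> 2" and V: "(\<Sum>e\<in>F. P e) \<le> V" "V \<ge> 4"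
  defines "X \<equiv> \<lambda>\<omega>. \<Sum>e\<in>F. c e * (of_bool (\<omega> e) - P e)"
  shows "measure_pmf.expectation (Pi_pmf I False (\<lambda>e. bernoulli_pmf (P e))) (\<lambda>\<omega>. (X \<omega>)\<^sup>2)
          \<le> 4 * exp 4 * V"
proof -
  let ?M = "Pi_pmf I False (\<lambda>e. bernoulli_pmf (P e))"
  define \<theta> where "\<theta> = 1 / sqrt V"
  have \<theta>: "\<theta> > 0" "\<theta>\<^sup>2 = 1 / V"
    using V by (auto simp: \<theta>_def power_divide)
  have "\<theta> \<le> 1 / sqrt 4"
    unfolding \<theta>_def using V by (intro divide_left_mono real_sqrt_le_mono) auto
  then have \<theta>1: "2 * \<bar>\<theta>\<bar> \<le> 1" using \<theta> by (simp add: real_sqrt_four)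
  have fin: "finite (set_pmf ?M)"
    by (rule finite_subset[OF set_Pi_pmf_subset'[OF I]]) (use I in auto)
  have quad: "y\<^sup>2 \<le> 2 * exp y + 2 * exp (- y)" for y :: real
  proof -
    have *: "y\<^sup>2 \<le> 2 * exp \<bar>y\<bar>"
      using exp_lower_Taylor_quadratic[of "\<bar>y\<bar>"] by simp
    show ?thesis
    proof (cases "y \<ge> 0")
      case True
      then show ?thesis using * exp_gt_zero[of "- y"] unfolding abs_of_nonneg[OF True] by linarith
    next
      case False
      then have "\<bar>y\<bar> = - y" by simp
      then show ?thesis using * exp_gt_zero[of y] by (simp only:)
    qed
  qed
  have "measure_pmf.expectation ?M (\<lambda>\<omega>. (X \<omega>)\<^sup>2)
      \<le> measure_pmf.expectation ?M (\<lambda>\<omega>. 2 * V * exp (\<theta> * X \<omega>) + 2 * V * exp ((- \<theta>) * X \<omega>))"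
  proof (intro integral_mono integrable_measure_pmf_finite fin)
    fix \<omega>
    show "(X \<omega>)\<^sup>2 \<le> 2 * V * exp (\<theta> * X \<omega>) + 2 * V * exp ((- \<theta>) * X \<omega>)"
      using mult_left_mono[OF quad[of "\<theta> * X \<omega>"], of V] V
      by (simp add: power_mult_distrib \<theta>(2) algebra_simps)
  qed
  also have "\<dots> = 2 * V * measure_pmf.expectation ?M (\<lambda>\<omega>. exp (\<theta> * X \<omega>))
                + 2 * V * measure_pmf.expectation ?M (\<lambda>\<omega>. exp ((- \<theta>) * X \<omega>))"
    by (subst Bochner_Integration.integral_add) (simp_all add: integrable_measure_pmf_finite fin)
  also have "\<dots> \<le> 2 * V * exp (4 * \<theta>\<^sup>2 * V) + 2 * V * exp (4 * (- \<theta>)\<^sup>2 * V)"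
    unfolding X_def using V \<theta>1
    by (intro add_mono mult_left_mono bernoulli_sum_mgf I F P c) auto
  also have "\<dots> = 4 * exp 4 * V"
    using V by (simp add: \<theta>(2))
  finally show ?thesis .
qed

text \<open>Unless some sum reaches \<open>T\<close>, squares truncated at the square of
  \<open>T\<close> are the true squares. They are bounded and, the sets being disjoint, independent,
  so Hoeffding's inequality keeps their total at the order of its mean, with no logarithmic factor.
  A union bound over the Chernoff tails handles the truncation.\<close>

lemma disjoint_bernoulli_sums:
  fixes c P :: "'a \<Rightarrow> real" and F :: "nat \<Rightarrow> 'a set" and T V :: real
  assumes I: "finite I" and F: "\<And>v. v < n \<Longrightarrow> F v \<subseteq> I" and disj: "disjoint_family_on F {..<n}"
    and P: "\<And>e. e \<in> I \<Longrightarrow> 0 \<le> P e \<and> P e \<le> 1" and c: "\<And>e. e \<in> I \<Longrightarrow> \<bar>c e\<bar> \<le> 2"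
    and V: "\<And>v. v < n \<Longrightarrow> (\<Sum>e\<in>F v. P e) \<le> V" "V \<ge> 4" and T: "0 < T" "T \<le> 4 * V" and n: "n > 0"
  defines "X \<equiv> \<lambda>v \<omega>. \<Sum>e\<in>F v. c e * (of_bool (\<omega> e) - P e)"
  shows "measure_pmf.prob (Pi_pmf I False (\<lambda>e. bernoulli_pmf (P e)))
            {\<omega>. (\<exists>v<n. \<bar>X v \<omega>\<bar> \<ge> T) \<or> (\<Sum>v<n. (X v \<omega>)\<^sup>2) \<ge> (4 * exp 4 + 1) * (real n * V)}
          \<le> 2 * real n * exp (- (T\<^sup>2 / (16 * V))) + exp (- 2 * (real n * V\<^sup>2 / T ^ 4))"
proof -
  let ?M = "Pi_pmf I False (\<lambda>e. bernoulli_pmf (P e))"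
  have fin: "finite (set_pmf ?M)"
    by (rule finite_subset[OF set_Pi_pmf_subset'[OF I]]) (use I in auto)
  define Y where "Y = (\<lambda>v \<omega>. min (T\<^sup>2) ((X v \<omega>)\<^sup>2))"
  \<comment> \<open>\<open>G\<close> is \<open>Y\<close> read as a function of the coordinates in
    \<open>F v\<close>, the form in which disjointness yields independence.\<close>
  define G where "G = (\<lambda>v \<omega>. min (T\<^sup>2) ((\<Sum>e\<in>F v. c e * (of_bool (\<omega> e) - P e))\<^sup>2))"
  have G_meas: "G v \<in> borel_measurable (PiM (F v) (\<lambda>_. count_space UNIV))" for v
    unfolding G_def
    by (intro borel_measurable_min borel_measurable_const borel_measurable_power borel_measurable_sum
          borel_measurable_times borel_measurable_diff measurable_compose[OF measurable_component_singleton]) auto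
  have "prob_space.indep_vars (measure_pmf ?M) (\<lambda>v. PiM (F v) (\<lambda>_. count_space UNIV)) (\<lambda>v \<omega>. restrict (\<lambda>e. \<omega> e) (F v)) {..<n}"
    using F by (intro prob_space.indep_vars_restrict[OF measure_pmf.prob_space_axioms indep_vars_Pi_pmf[OF I] _ disj]) auto
  from prob_space.indep_vars_compose2[OF measure_pmf.prob_space_axioms this G_meas]
  have "prob_space.indep_vars (measure_pmf ?M) (\<lambda>_. borel) (\<lambda>v \<omega>. G v (restrict (\<lambda>e. \<omega> e) (F v))) {..<n}" .
  also have "(\<lambda>v \<omega>. G v (restrict (\<lambda>e. \<omega> e) (F v))) = Y"
    by (auto simp: G_def Y_def X_def fun_eq_iff intro!: arg_cong2[of _ _ _ _ min] arg_cong[of _ _ "\<lambda>x. x\<^sup>2"] sum.cong)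
  finally have indep: "prob_space.indep_vars (measure_pmf ?M) (\<lambda>_. borel) Y {..<n}" .
  interpret H: Hoeffding_ineq "measure_pmf ?M" "{..<n}" Y "\<lambda>_. 0" "\<lambda>_. T\<^sup>2" "\<Sum>v<n. measure_pmf.expectation ?M (Y v)"
    by unfold_locales (use indep in \<open>auto simp: Y_def\<close>)
  have mean: "(\<Sum>v<n. measure_pmf.expectation ?M (Y v)) \<le> 4 * exp 4 * (real n * V)"
  proof -
    have "(\<Sum>v<n. measure_pmf.expectation ?M (Y v)) \<le> (\<Sum>v<n. 4 * exp 4 * V)"
    proof (rule sum_mono)
      fix v assume v: "v \<in> {..<n}"
      have "measure_pmf.expectation ?M (Y v) \<le> measure_pmf.expectation ?M (\<lambda>\<omega>. (X v \<omega>)\<^sup>2)"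
        by (intro integral_mono integrable_measure_pmf_finite fin) (simp add: Y_def)
      also have "\<dots> \<le> 4 * exp 4 * V"
        unfolding X_def using v F by (intro bernoulli_sum_second_moment I F P c V) auto
      finally show "measure_pmf.expectation ?M (Y v) \<le> 4 * exp 4 * V" .
    qed
    then show ?thesis by (simp add: mult_ac)
  qed
  let ?A = "\<lambda>v. {\<omega>. \<bar>X v \<omega>\<bar> \<ge> T}"
  let ?B = "{\<omega>. (\<Sum>v<n. Y v \<omega>) \<ge> (\<Sum>v<n. measure_pmf.expectation ?M (Y v)) + real n * V}"
  have "{\<omega>. (\<exists>v<n. \<bar>X v \<omega>\<bar> \<ge> T) \<or> (\<Sum>v<n. (X v \<omega>)\<^sup>2) \<ge> (4 * exp 4 + 1) * (real n * V)}
      \<subseteq> (\<Union>v<n. ?A v) \<union> ?B"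
  proof
    fix \<omega>
    assume \<omega>: "\<omega> \<in> {\<omega>. (\<exists>v<n. \<bar>X v \<omega>\<bar> \<ge> T) \<or> (\<Sum>v<n. (X v \<omega>)\<^sup>2) \<ge> (4 * exp 4 + 1) * (real n * V)}"
    show "\<omega> \<in> (\<Union>v<n. ?A v) \<union> ?B"
    proof (cases "\<exists>v<n. \<bar>X v \<omega>\<bar> \<ge> T")
      case False
      then have "Y v \<omega> = (X v \<omega>)\<^sup>2" if "v < n" for v
        using that power_mono[of "\<bar>X v \<omega>\<bar>" T 2] by (auto simp: Y_def min_def not_le)
      then have "(\<Sum>v<n. Y v \<omega>) = (\<Sum>v<n. (X v \<omega>)\<^sup>2)" by simp
      then show ?thesis using \<omega> False mean by (simp add: algebra_simps)
    qed auto
  qed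
  then have "measure_pmf.prob ?M {\<omega>. (\<exists>v<n. \<bar>X v \<omega>\<bar> \<ge> T) \<or> (\<Sum>v<n. (X v \<omega>)\<^sup>2) \<ge> (4 * exp 4 + 1) * (real n * V)}
      \<le> measure_pmf.prob ?M ((\<Union>v<n. ?A v) \<union> ?B)"
    by (intro measure_pmf.finite_measure_mono) auto
  also have "\<dots> \<le> (\<Sum>v<n. measure_pmf.prob ?M (?A v)) + measure_pmf.prob ?M ?B"
    by (rule order_trans[OF measure_Un_le add_right_mono])
       (auto intro!: measure_pmf.finite_measure_subadditive_finite)
  also have "\<dots> \<le> (\<Sum>v<n. 2 * exp (- (T\<^sup>2 / (16 * V)))) + exp (- 2 * (real n * V)\<^sup>2 / (\<Sum>v<n. (T\<^sup>2 - 0)\<^sup>2))"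
  proof (intro add_mono sum_mono)
    fix v assume v: "v \<in> {..<n}"
    show "measure_pmf.prob ?M (?A v) \<le> 2 * exp (- (T\<^sup>2 / (16 * V)))"
      unfolding X_def using v F T V(2) by (intro bernoulli_sum_tail I F P c V(1)) auto
  next
    \<comment> \<open>The allowed excess \<open>real n * V\<close> has the order of the bound on the
      mean; the squared ranges add up to n T^4.\<close>
    show "measure_pmf.prob ?M ?B \<le> exp (- 2 * (real n * V)\<^sup>2 / (\<Sum>v<n. (T\<^sup>2 - 0)\<^sup>2))"
      using H.Hoeffding_ineq_ge[of "real n * V"] n V T by simp
  qed
  also have "\<dots> = 2 * real n * exp (- (T\<^sup>2 / (16 * V))) + exp (- 2 * (real n * V\<^sup>2 / T ^ 4))"
  proof -
    have "- 2 * (real n * V)\<^sup>2 / (\<Sum>v<n. (T\<^sup>2 - 0)\<^sup>2) = - 2 * (real n * V\<^sup>2 / T ^ 4)"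
      using n T by (simp add: power_mult_distrib power2_eq_square[of "real n"] flip: power_mult)
    then show ?thesis by simp
  qed
  finally show ?thesis .
qed

subsection \<open>The two-block random graph\<close>

lemma graph_conv_eq_walk_pow:
  assumes A: "A \<in> carrier_mat n n" and a: "\<And>v w. v < n \<Longrightarrow> w < n \<Longrightarrow> A $$ (v, w) = a v w"
    and v: "v < n"
  shows "graph_conv A k x $ v = (walk n a ^^ k) x v"
proof -
  let ?P = "walk n a"
  have deg: "node_degree A v = weighted_degree n a v" if "v < n" for v
    using A a that by (auto simp: node_degree_def weighted_degree_def scalar_prod_def atLeast0LessThan)
  have M: "conv_mat A = Matrix.mat n n (\<lambda>(i, j). inverse (node_degree A i) * A $$ (i, j))"
    unfolding conv_mat_def using A by (subst mat_diag_mult_left) auto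
  have carr: "conv_mat A \<in> carrier_mat n n"
    by (simp add: M)
  have step: "conv_mat A *\<^sub>v Matrix.vec n x = Matrix.vec n (?P x)" for x
    by (rule eq_vecI)
      (auto simp: M scalar_prod_def walk_def deg a atLeast0LessThan sum_divide_distrib field_simps
        intro!: sum.cong)
  have "graph_conv A k x = Matrix.vec n ((?P ^^ k) x)" for x
  proof (induction k arbitrary: x)
    case 0
    show ?case using A carr by (auto simp: graph_conv_def)
  next
    case (Suc k)
    \<comment> \<open>The matrix power exposes its rightmost factor, which acts on \<open>x\<close>
      first; hence the induction over arbitrary \<open>x\<close>.\<close>
    have "graph_conv A (Suc k) x = conv_mat A ^\<^sub>m k *\<^sub>v (conv_mat A *\<^sub>v Matrix.vec n x)"
      using A carr
      by (simp add: graph_conv_def assoc_mult_mat_vec[OF pow_carrier_mat[OF carr] carr])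
    also have "\<dots> = graph_conv A k (?P x)"
      using A by (simp add: step graph_conv_def)
    finally show ?case
      unfolding Suc.IH funpow_Suc_right o_def .
  qed
  then show ?thesis using v by simp
qed

text \<open>The sign is -1 on the first class, so that pairing with it gives class 2 minus class
  1.\<close>

definition class_sign :: "nat \<Rightarrow> nat \<Rightarrow> real" where
  "class_sign n v = (if v \<in> class1 n then - 1 else 1)"

lemma class_sign_square [simp]: "class_sign n v * class_sign n v = 1"
  by (simp add: class_sign_def)

lemma abs_class_sign [simp]: "\<bar>class_sign n v\<bar> = 1"
  by (simp add: class_sign_def)

lemma sum_classes:
  fixes f :: "nat \<Rightarrow> real"
  assumes "even n"
  shows "(\<Sum>v<n. f v) = (\<Sum>v\<in>class1 n. f v) + (\<Sum>v\<in>class2 n. f v)"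
proof -
  have "{..<n} = class1 n \<union> class2 n" "class1 n \<inter> class2 n = {}"
    by (auto simp: class1_def class2_def)
  then show ?thesis
    by (simp add: sum.union_disjoint class1_def class2_def)
qed

lemma class_sign_class:
  "v \<in> class1 n \<Longrightarrow> class_sign n v = - 1" "v \<in> class2 n \<Longrightarrow> class_sign n v = 1"
  by (auto simp: class_sign_def class1_def class2_def)

lemma card_classes:
  assumes "even n"
  shows "real (card (class1 n)) = real n / 2" "real (card (class2 n)) = real n / 2"
  using assms by (auto simp: class1_def class2_def elim!: evenE)

lemma sum_class_sign:
  assumes "even n"
  shows "(\<Sum>v<n. class_sign n v) = 0"
  using card_classes[OF assms] by (simp add: sum_classes[OF assms] class_sign_class)

text \<open>The mean vector is a constant plus half of \<open>\<mu>2 - \<mu>1\<close> times the sign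
  vector. With positive degrees the walk fixes constants, and these cancel in the difference because
  the classes have equal size.\<close>

lemma class_mean_difference:
  assumes n: "even n" "n > 0" and A: "A \<in> carrier_mat n n"
    and a: "\<And>v w. v < n \<Longrightarrow> w < n \<Longrightarrow> A $$ (v, w) = a v w"
    and deg: "\<And>v. v < n \<Longrightarrow> weighted_degree n a v > 0"
  shows "class_mean (class2 n) A k (node_mean n \<mu>1 \<mu>2) - class_mean (class1 n) A k (node_mean n \<mu>1 \<mu>2)
    = (\<mu>2 - \<mu>1) / real n
        * (\<Sum>v<n. class_sign n v * (walk n a ^^ k) (class_sign n) v)"
proof -
  let ?P = "walk n a" and ?s = "class_sign n" and ?\<mu> = "node_mean n \<mu>1 \<mu>2"
  have \<mu>: "?\<mu> = (\<lambda>v. (\<mu>1 + \<mu>2) / 2 * 1 + (\<mu>2 - \<mu>1) / 2 * ?s v)"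
    by (auto simp: node_mean_def class_sign_def fun_eq_iff field_simps)
  have one: "(?P ^^ k) (\<lambda>_. 1) v = 1" if "v < n" for v
    using that
  proof (induction k arbitrary: v)
    case (Suc k)
    then show ?case using deg[of v] by (simp add: walk_def weighted_degree_def)
  qed simp
  have pow: "(?P ^^ k) ?\<mu> v = (\<mu>1 + \<mu>2) / 2 + (\<mu>2 - \<mu>1) / 2 * (?P ^^ k) ?s v" if "v < n" for v
    unfolding \<mu> walk_pow_linear using one[OF that] by simp
  have conv: "graph_conv A k ?\<mu> $ v = (?P ^^ k) ?\<mu> v" if "v < n" for v
    using graph_conv_eq_walk_pow[OF A a that] .
  have "class_mean (class2 n) A k ?\<mu> - class_mean (class1 n) A k ?\<mu>
      = 2 / real n * (\<Sum>v<n. ?s v * graph_conv A k ?\<mu> $ v)"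
    using A by (simp add: class_mean_def sum_classes[OF n(1)] class_sign_class sum_negf algebra_simps)
  also have "(\<Sum>v<n. ?s v * graph_conv A k ?\<mu> $ v)
      = (\<Sum>v<n. (\<mu>1 + \<mu>2) / 2 * ?s v + (\<mu>2 - \<mu>1) / 2 * (?s v * (?P ^^ k) ?s v))"
    by (intro sum.cong refl) (simp add: conv pow algebra_simps)
  also have "\<dots> = (\<mu>2 - \<mu>1) / 2 * (\<Sum>v<n. ?s v * (?P ^^ k) ?s v)"
    unfolding sum.distrib sum_distrib_left[symmetric] sum_class_sign[OF n(1)] by simp
  finally show ?thesis by simp
qed

section \<open>Edge indicators, and rows cut at the diagonal\<close>

definition edges :: "nat \<Rightarrow> (nat \<times> nat) set" where
  "edges n = {(u, v). u < v \<and> v < n}"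

text \<open>The diagonal value is \<open>p\<close> although there are no loops. For even
  \<open>n\<close> this makes every row sum exactly \<open>real n * (p + q) / 2\<close>, at the
  price of a diagonal correction in \<open>row_split\<close>.\<close>

definition edge_prob :: "nat \<Rightarrow> real \<Rightarrow> real \<Rightarrow> nat \<times> nat \<Rightarrow> real" where
  "edge_prob n p q = (\<lambda>(u, v). if u \<in> class1 n \<longleftrightarrow> v \<in> class1 n then p else q)"

definition random_edges :: "nat \<Rightarrow> real \<Rightarrow> real \<Rightarrow> (nat \<times> nat \<Rightarrow> bool) pmf" where
  "random_edges n p q = Pi_pmf (edges n) False (\<lambda>e. bernoulli_pmf (edge_prob n p q e))"

definition adj :: "(nat \<times> nat \<Rightarrow> bool) \<Rightarrow> nat \<Rightarrow> nat \<Rightarrow> real" where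
  "adj E v w = of_bool (v \<noteq> w \<and> E (min v w, max v w))"

lemma sbm_eq: "sbm n p q = map_pmf (adjacency n) (random_edges n p q)"
  unfolding sbm_def random_edges_def edges_def edge_prob_def
  by (intro arg_cong2[of _ _ _ _ map_pmf] refl arg_cong[of _ _ "Pi_pmf _ _"]) (auto simp: fun_eq_iff)

lemma finite_edges: "finite (edges n)"
  by (rule finite_subset[of _ "{..<n} \<times> {..<n}"]) (auto simp: edges_def)

text \<open>Rows \<open>v\<close> and \<open>w\<close> of the adjacency matrix share the edge
  between them and are dependent. Cut at the diagonal, the rows give two families of edge sets, this
  one and \<open>down_edges\<close>, each of them disjoint over \<open>v\<close>.\<close>

definition up_edges :: "nat \<Rightarrow> nat \<Rightarrow> (nat \<times> nat) set" where
  "up_edges n v = {v} \<times> {v<..<n}"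

definition down_edges :: "nat \<Rightarrow> (nat \<times> nat) set" where
  "down_edges v = {..<v} \<times> {v}"

lemma sum_up_edges: "(\<Sum>e\<in>up_edges n v. f e) = (\<Sum>w\<in>{v<..<n}. f (v, w))"
  unfolding up_edges_def by (simp add: sum.cartesian_product')

lemma sum_down_edges: "(\<Sum>e\<in>down_edges v. f e) = (\<Sum>w<v. f (w, v))"
  unfolding down_edges_def by (simp add: sum.cartesian_product')

lemma sum_up_edges_total:
  "(\<Sum>v<n. \<Sum>e\<in>up_edges n v. f e) = (\<Sum>e\<in>edges n. f e)"
proof -
  have "edges n = Sigma {..<n} (\<lambda>v. {v<..<n})"
    by (auto simp: edges_def)
  then show ?thesis unfolding sum_up_edges by (simp add: sum.Sigma)
qed

lemma sum_down_edges_total: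
  "(\<Sum>v<n. \<Sum>e\<in>down_edges v. f e) = (\<Sum>e\<in>edges n. f e)"
proof -
  have "(\<Sum>v<n. \<Sum>e\<in>down_edges v. f e) = (\<Sum>(v, w)\<in>Sigma {..<n} (\<lambda>v. {..<v}). f (w, v))"
    unfolding sum_down_edges by (simp add: sum.Sigma)
  also have "\<dots> = (\<Sum>e\<in>edges n. f e)"
    by (rule sum.reindex_bij_witness[of _ prod.swap prod.swap]) (auto simp: edges_def)
  finally show ?thesis .
qed

lemma sum_split_at:
  fixes f :: "nat \<Rightarrow> real"
  assumes "v < n"
  shows "(\<Sum>w<n. f w) = (\<Sum>w\<in>{v<..<n}. f w) + (\<Sum>w<v. f w) + f v"
proof -
  have "{..<n} = insert v ({..<v} \<union> {v<..<n})"
    using assms by auto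
  then have "(\<Sum>w<n. f w) = f v + (\<Sum>w\<in>{..<v} \<union> {v<..<n}. f w)"
    by simp
  also have "(\<Sum>w\<in>{..<v} \<union> {v<..<n}. f w) = (\<Sum>w<v. f w) + (\<Sum>w\<in>{v<..<n}. f w)"
    by (rule sum.union_disjoint) auto
  finally show ?thesis by simp
qed

text \<open>On the diagonal \<open>adj\<close> is 0 while \<open>edge_prob\<close> is
  \<open>p\<close>, whence the last term.\<close>

lemma row_split:
  fixes g :: "nat \<Rightarrow> real"
  assumes v: "v < n"
  shows "(\<Sum>w<n. (adj E v w - edge_prob n p q (v, w)) * g w)
    = (\<Sum>e\<in>up_edges n v. g (snd e) * (of_bool (E e) - edge_prob n p q e))
      + (\<Sum>e\<in>down_edges v. g (fst e) * (of_bool (E e) - edge_prob n p q e)) - p * g v"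
  unfolding sum_split_at[OF v] sum_up_edges sum_down_edges
  by (auto simp: adj_def edge_prob_def min_def max_def algebra_simps intro!: arg_cong2[of _ _ _ _ "(+)"] sum.cong)

lemma sum_edge_prob:
  assumes "even n"
  shows "(\<Sum>w<n. edge_prob n p q (v, w)) = real n * (p + q) / 2"
proof -
  have "(\<Sum>w<n. edge_prob n p q (v, w))
      = (\<Sum>w<n. (p + q) / 2 + (p - q) / 2 * class_sign n v * class_sign n w)"
    by (intro sum.cong refl) (auto simp: edge_prob_def class_sign_def field_simps)
  also have "\<dots> = real n * (p + q) / 2"
    unfolding sum.distrib sum_distrib_left[symmetric] sum_class_sign[OF assms] by simp
  finally show ?thesis .
qed

text \<open>The sign vector is an eigenvector of the matrix of probabilities, with eigenvalue
  \<open>(p - q) / (p + q)\<close> times the common row sum. So the residual of the walk, scaled by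
  the degree, is centered up to the diagonal.\<close>

lemma sum_edge_prob_sign:
  assumes "even n" "p + q \<noteq> 0"
  shows "(\<Sum>w<n. edge_prob n p q (v, w) * (class_sign n w - (p - q) / (p + q) * class_sign n v)) = 0"
proof -
  have "(\<Sum>w<n. edge_prob n p q (v, w) * class_sign n w)
      = (\<Sum>w<n. (p + q) / 2 * class_sign n w + (p - q) / 2 * class_sign n v)"
    by (intro sum.cong refl) (auto simp: edge_prob_def class_sign_def field_simps)
  also have "\<dots> = real n * (p - q) / 2 * class_sign n v"
    unfolding sum.distrib sum_distrib_left[symmetric] sum_class_sign[OF assms(1)] by simp
  finally have 1: "(\<Sum>w<n. edge_prob n p q (v, w) * class_sign n w)
      = real n * (p - q) / 2 * class_sign n v" .
  have "(\<Sum>w<n. edge_prob n p q (v, w) * (class_sign n w - (p - q) / (p + q) * class_sign n v))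
      = (\<Sum>w<n. edge_prob n p q (v, w) * class_sign n w)
        - (\<Sum>w<n. edge_prob n p q (v, w)) * ((p - q) / (p + q) * class_sign n v)"
    by (simp only: right_diff_distrib sum_subtractf sum_distrib_right)
  then show ?thesis
    using assms unfolding 1 sum_edge_prob[OF assms(1)] by (simp add: field_simps)
qed

subsection \<open>The walk on a typical graph\<close>

definition deviation ::
  "nat \<Rightarrow> real \<Rightarrow> real \<Rightarrow> (nat \<times> nat \<Rightarrow> real) \<Rightarrow> (nat \<times> nat) set \<Rightarrow> (nat \<times> nat \<Rightarrow> bool) \<Rightarrow> real" where
  "deviation n p q c F E = (\<Sum>e\<in>F. c e * (of_bool (E e) - edge_prob n p q e))"

text \<open>The coefficient of an edge in the scaled residual at its smaller endpoint;
  \<open>down_coeff\<close> is the one at its larger endpoint. Multiplied by the sign of that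
  endpoint, each becomes \<open>pair_coeff\<close>.\<close>

definition up_coeff :: "nat \<Rightarrow> real \<Rightarrow> nat \<times> nat \<Rightarrow> real" where
  "up_coeff n lam e = class_sign n (snd e) - lam * class_sign n (fst e)"

definition down_coeff :: "nat \<Rightarrow> real \<Rightarrow> nat \<times> nat \<Rightarrow> real" where
  "down_coeff n lam e = class_sign n (fst e) - lam * class_sign n (snd e)"

definition pair_coeff :: "nat \<Rightarrow> real \<Rightarrow> nat \<times> nat \<Rightarrow> real" where
  "pair_coeff n lam e = class_sign n (fst e) * class_sign n (snd e) - lam"

lemma abs_coeff_le:
  assumes "\<bar>lam\<bar> \<le> 1"
  shows "\<bar>up_coeff n lam e\<bar> \<le> 2" "\<bar>down_coeff n lam e\<bar> \<le> 2" "\<bar>pair_coeff n lam e\<bar> \<le> 2"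
  using assms by (auto simp: up_coeff_def down_coeff_def pair_coeff_def class_sign_def)

lemma square_sum_three_le: "(a + b - c)\<^sup>2 \<le> 3 * (a\<^sup>2 + b\<^sup>2 + c\<^sup>2)" for a b c :: real
proof -
  \<comment> \<open>This sum of squares is exactly the slack in the inequality.\<close>
  have "0 \<le> (a - b)\<^sup>2 + (a + c)\<^sup>2 + (b + c)\<^sup>2" by simp
  then show ?thesis by (simp add: power2_eq_square algebra_simps)
qed

lemma sum_square_sum_three_le:
  fixes a b c :: "nat \<Rightarrow> real"
  assumes "(\<Sum>v<n. (a v)\<^sup>2) \<le> Q" "(\<Sum>v<n. (b v)\<^sup>2) \<le> Q" "\<And>v. v < n \<Longrightarrow> (c v)\<^sup>2 \<le> 1" "real n \<le> Q"
  shows "(\<Sum>v<n. (a v + b v - c v)\<^sup>2) \<le> 9 * Q"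
proof -
  have "(\<Sum>v<n. (a v + b v - c v)\<^sup>2) \<le> (\<Sum>v<n. 3 * ((a v)\<^sup>2 + (b v)\<^sup>2 + 1))"
  proof (rule sum_mono)
    fix v assume "v \<in> {..<n}"
    then show "(a v + b v - c v)\<^sup>2 \<le> 3 * ((a v)\<^sup>2 + (b v)\<^sup>2 + 1)"
      using square_sum_three_le[of "a v" "b v" "c v"] assms(3)[of v] by simp
  qed
  also have "\<dots> = 3 * ((\<Sum>v<n. (a v)\<^sup>2) + (\<Sum>v<n. (b v)\<^sup>2) + real n)"
    by (simp add: sum.distrib flip: sum_distrib_left)
  finally show ?thesis using assms by simp
qed

text \<open>The deterministic half of the argument: bounds on linear forms in the edges supply the
  hypotheses of \<open>walk_pow_approx_eigenvector\<close>, with \<open>18 * Q / D\<close> for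
  \<open>M\<close> and \<open>2 * S + real n\<close> for \<open>R\<close>.\<close>

lemma walk_pow_class_sign_bound:
  fixes n :: nat and p q T Q S :: real
  defines "lam \<equiv> (p - q) / (p + q)" and "D \<equiv> real n * (p + q) / 2"
  assumes n: "even n" "n > 0" and pq: "0 < q" "q < p" "p \<le> 1" and D: "D \<ge> 8" and T: "T \<le> D / 8"
    and du: "\<And>v. v < n \<Longrightarrow> \<bar>deviation n p q (\<lambda>_. 1) (up_edges n v) E\<bar> \<le> T"
    and dd: "\<And>v. v < n \<Longrightarrow> \<bar>deviation n p q (\<lambda>_. 1) (down_edges v) E\<bar> \<le> T"
    and du2: "(\<Sum>v<n. (deviation n p q (\<lambda>_. 1) (up_edges n v) E)\<^sup>2) \<le> Q"
    and dd2: "(\<Sum>v<n. (deviation n p q (\<lambda>_. 1) (down_edges v) E)\<^sup>2) \<le> Q"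
    and uu2: "(\<Sum>v<n. (deviation n p q (up_coeff n lam) (up_edges n v) E)\<^sup>2) \<le> Q"
    and ud2: "(\<Sum>v<n. (deviation n p q (down_coeff n lam) (down_edges v) E)\<^sup>2) \<le> Q"
    and Q: "real n \<le> Q"
    and S: "\<bar>deviation n p q (pair_coeff n lam) (edges n) E\<bar> \<le> S"
  shows "\<forall>v<n. weighted_degree n (adj E) v > 0"
    and "\<bar>(\<Sum>v<n. class_sign n v * (walk n (adj E) ^^ k) (class_sign n) v) - lam ^ k * real n\<bar>
          \<le> real k * ((2 * S + real n + real k * (18 * Q / D)) / D)"
proof -
  let ?s = "class_sign n" and ?a = "adj E"
  let ?d = "weighted_degree n ?a" and ?pi = "\<lambda>v w. edge_prob n p q (v, w)"
  \<comment> \<open>The residual multiplied by the degree is linear in the edges; division by the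
    random degree is postponed.\<close>
  define u where "u = (\<lambda>v. (\<Sum>w<n. ?a v w * (?s w - lam * ?s v)))"
  have lam: "0 \<le> lam" "lam \<le> 1"
    using pq by (auto simp: lam_def)
  have d_eq: "?d v - D = deviation n p q (\<lambda>_. 1) (up_edges n v) E
      + deviation n p q (\<lambda>_. 1) (down_edges v) E - p" if v: "v < n" for v
  proof -
    have "?d v - D = (\<Sum>w<n. (?a v w - ?pi v w) * 1)"
      by (simp add: weighted_degree_def sum_subtractf sum_edge_prob[OF n(1)] D_def)
    also have "\<dots> = deviation n p q (\<lambda>_. 1) (up_edges n v) E
      + deviation n p q (\<lambda>_. 1) (down_edges v) E - p"
      unfolding row_split[OF v] deviation_def by simp
    finally show ?thesis .
  qed
  have u_eq: "u v = deviation n p q (up_coeff n lam) (up_edges n v) E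
      + deviation n p q (down_coeff n lam) (down_edges v) E - p * (1 - lam) * ?s v" if v: "v < n" for v
  proof -
    have "u v = (\<Sum>w<n. (?a v w - ?pi v w) * (?s w - lam * ?s v))"
      using sum_edge_prob_sign[OF n(1), of p q v] pq
      by (simp add: u_def lam_def left_diff_distrib sum_subtractf)
    also have "\<dots> = deviation n p q (up_coeff n lam) (up_edges n v) E
      + deviation n p q (down_coeff n lam) (down_edges v) E - p * (?s v - lam * ?s v)"
      unfolding row_split[OF v] deviation_def
      by (auto simp: up_coeff_def down_coeff_def up_edges_def down_edges_def
          intro!: arg_cong2[of _ _ _ _ "(+)"] sum.cong)
    finally show ?thesis by (simp add: algebra_simps)
  qed
  \<comment> \<open>The two half-row deviations and the diagonal term \<open>p \<le> 1\<close> each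
    cost at most \<open>D / 8\<close>.\<close>
  have d_ge: "?d v \<ge> D / 2" if v: "v < n" for v
    using d_eq[OF v] du[OF v] dd[OF v] pq D T by (simp add: abs_le_iff)
  then show deg: "\<forall>v<n. ?d v > 0"
    using D by (metis half_gt_zero less_le_trans zero_less_numeral)
  interpret weighted_graph n ?a
    by unfold_locales (use deg in \<open>auto simp: adj_def min.commute max.commute\<close>)
  define x where "x = (\<lambda>v. walk n ?a ?s v - lam * ?s v)"
  define f where "f = (\<lambda>v. (D / ?d v - 1) * ?s v)"
  have x_eq: "?d v * x v = u v" if "v < n" for v
  proof -
    have "?d v \<noteq> 0" using deg that by force
    then have "?d v * x v = (\<Sum>w<n. ?a v w * ?s w) - lam * ?s v * ?d v"
      by (simp add: x_def walk_def right_diff_distrib)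
    also have "\<dots> = u v"
      unfolding u_def weighted_degree_def
      by (simp add: right_diff_distrib sum_subtractf sum_distrib_left mult_ac)
    finally show ?thesis .
  qed
  have deg_inner_le: "deg_inner y y \<le> 18 * Q / D"
    if y: "\<And>v. v < n \<Longrightarrow> (?d v * y v)\<^sup>2 = (z v)\<^sup>2" and z: "(\<Sum>v<n. (z v)\<^sup>2) \<le> 9 * Q" for y z
  proof -
    have "deg_inner y y \<le> (\<Sum>v<n. 2 / D * (z v)\<^sup>2)"
      unfolding deg_inner_def
    proof (rule sum_mono)
      fix v assume "v \<in> {..<n}"
      then have v: "v < n" by simp
      have "?d v * y v * y v = (z v)\<^sup>2 / ?d v"
        unfolding y[OF v, symmetric] using deg v by (simp add: power2_eq_square)
      also have "\<dots> \<le> (z v)\<^sup>2 / (D / 2)"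
        using d_ge[OF v] D by (intro divide_left_mono) auto
      finally show "?d v * y v * y v \<le> 2 / D * (z v)\<^sup>2" by (simp add: mult.commute)
    qed
    also have "\<dots> = 2 / D * (\<Sum>v<n. (z v)\<^sup>2)"
      by (simp only: sum_distrib_left)
    also have "\<dots> \<le> 2 / D * (9 * Q)"
      using z D by (intro mult_left_mono) auto
    finally show ?thesis by simp
  qed
  have "\<bar>p * (1 - lam) * ?s v\<bar> \<le> 1" for v
    using pq lam mult_le_one[of p "1 - lam"] by (simp add: abs_mult)
  then have c_u: "(p * (1 - lam) * ?s v)\<^sup>2 \<le> 1" for v
    by (simp add: abs_square_le_1)
  have c_d: "p\<^sup>2 \<le> 1"
    using pq by (simp add: abs_square_le_1)
  have "(\<Sum>v<n. (u v)\<^sup>2) \<le> 9 * Q"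
    using sum_square_sum_three_le[OF uu2 ud2 c_u Q] u_eq by simp
  then have xx: "deg_inner x x \<le> 18 * Q / D"
    by (intro deg_inner_le[where z = u]) (simp_all add: x_eq)
  have "(\<Sum>v<n. (?d v - D)\<^sup>2) \<le> 9 * Q"
    using sum_square_sum_three_le[OF du2 dd2 c_d Q] d_eq by simp
  then have ff: "deg_inner f f \<le> 18 * Q / D"
  proof (rule deg_inner_le[rotated])
    fix v assume "v < n"
    then have "?d v \<noteq> 0" using deg by force
    then have "?d v * f v = (D - ?d v) * ?s v"
      by (simp add: f_def field_simps)
    then show "(?d v * f v)\<^sup>2 = (?d v - D)\<^sup>2"
      by (simp add: power_mult_distrib power2_commute power2_eq_square[of "?s v"])
  qed
  \<comment> \<open>Every edge receives the coefficient \<open>pair_coeff\<close> from both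
    endpoints, so this is twice a single linear form in independent edges, minus a diagonal term of
    at most \<open>real n\<close>.\<close>
  have "deg_inner ?s x = (\<Sum>v<n. ?s v * u v)"
    unfolding deg_inner_def by (intro sum.cong refl) (simp flip: x_eq)
  also have "\<dots> = (\<Sum>v<n. \<Sum>e\<in>up_edges n v. pair_coeff n lam e * (of_bool (E e) - edge_prob n p q e))
      + (\<Sum>v<n. \<Sum>e\<in>down_edges v. pair_coeff n lam e * (of_bool (E e) - edge_prob n p q e))
      - (\<Sum>v<n. p * (1 - lam))"
    unfolding sum.distrib[symmetric] sum_subtractf[symmetric]
  proof (rule sum.cong[OF refl])
    fix v assume "v \<in> {..<n}"
    then have v: "v < n" by simp
    have 1: "?s v * deviation n p q (up_coeff n lam) (up_edges n v) E
        = (\<Sum>e\<in>up_edges n v. pair_coeff n lam e * (of_bool (E e) - edge_prob n p q e))"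
      unfolding deviation_def sum_distrib_left
      by (intro sum.cong refl)
        (auto simp: up_edges_def up_coeff_def pair_coeff_def class_sign_def)
    have 2: "?s v * deviation n p q (down_coeff n lam) (down_edges v) E
        = (\<Sum>e\<in>down_edges v. pair_coeff n lam e * (of_bool (E e) - edge_prob n p q e))"
      unfolding deviation_def sum_distrib_left
      by (intro sum.cong refl)
        (auto simp: down_edges_def down_coeff_def pair_coeff_def class_sign_def)
    have 3: "?s v * (p * (1 - lam) * ?s v) = p * (1 - lam)"
      by (simp add: class_sign_def)
    show "?s v * u v
      = (\<Sum>e\<in>up_edges n v. pair_coeff n lam e * (of_bool (E e) - edge_prob n p q e))
      + (\<Sum>e\<in>down_edges v. pair_coeff n lam e * (of_bool (E e) - edge_prob n p q e)) - p * (1 - lam)"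
      unfolding u_eq[OF v] right_diff_distrib[of "?s v"] distrib_left[of "?s v"] 1 2 3 ..
  qed
  also have "\<dots> = 2 * deviation n p q (pair_coeff n lam) (edges n) E - real n * (p * (1 - lam))"
    unfolding sum_up_edges_total sum_down_edges_total deviation_def by simp
  finally have sx_eq: "deg_inner ?s x
      = 2 * deviation n p q (pair_coeff n lam) (edges n) E - real n * (p * (1 - lam))" .
  have "0 \<le> p * (1 - lam)" "p * (1 - lam) \<le> 1"
    using pq lam by (auto intro: mult_le_one)
  then have "0 \<le> real n * (p * (1 - lam))" "real n * (p * (1 - lam)) \<le> real n"
    by (simp_all add: mult_left_le)
  then have sx: "\<bar>deg_inner ?s x\<bar> \<le> 2 * S + real n"
    unfolding sx_eq using S by linarith
  show "\<bar>(\<Sum>v<n. ?s v * (walk n ?a ^^ k) ?s v) - lam ^ k * real n\<bar>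
          \<le> real k * ((2 * S + real n + real k * (18 * Q / D)) / D)"
    using xx ff sx lam D Q unfolding x_def f_def
    by (intro walk_pow_approx_eigenvector) auto
qed

subsection \<open>Concentration\<close>

lemma edge_prob_nonneg: "0 < q \<Longrightarrow> q < p \<Longrightarrow> 0 \<le> edge_prob n p q e"
  by (auto simp: edge_prob_def split: prod.split)

lemma edge_prob_bounds:
  assumes "0 < q" "q < p" "p \<le> 1"
  shows "0 \<le> edge_prob n p q e \<and> edge_prob n p q e \<le> 1"
  using assms by (auto simp: edge_prob_def split: prod.split)

lemma sum_edge_prob_up_le:
  assumes "even n" "0 < q" "q < p" "v < n"
  shows "(\<Sum>e\<in>up_edges n v. edge_prob n p q e) \<le> real n * (p + q) / 2"
  unfolding sum_up_edges sum_edge_prob[OF assms(1), of p q v, symmetric]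
  by (intro sum_mono2) (auto intro: edge_prob_nonneg[OF assms(2,3)])

lemma sum_edge_prob_down_le:
  assumes "even n" "0 < q" "q < p" "v < n"
  shows "(\<Sum>e\<in>down_edges v. edge_prob n p q e) \<le> real n * (p + q) / 2"
proof -
  have "(\<Sum>e\<in>down_edges v. edge_prob n p q e) = (\<Sum>w<v. edge_prob n p q (v, w))"
    unfolding sum_down_edges by (intro sum.cong refl) (auto simp: edge_prob_def)
  also have "\<dots> \<le> (\<Sum>w<n. edge_prob n p q (v, w))"
    using assms(4) by (intro sum_mono2) (auto intro: edge_prob_nonneg[OF assms(2,3)])
  finally show ?thesis using sum_edge_prob[OF assms(1)] by simp
qed

lemma disjoint_up_edges: "disjoint_family_on (up_edges n) A"
  by (auto simp: disjoint_family_on_def up_edges_def)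

lemma disjoint_down_edges: "disjoint_family_on down_edges A"
  by (auto simp: disjoint_family_on_def down_edges_def)

lemma up_edges_subset: "v < n \<Longrightarrow> up_edges n v \<subseteq> edges n"
  by (auto simp: up_edges_def edges_def)

lemma down_edges_subset: "v < n \<Longrightarrow> down_edges v \<subseteq> edges n"
  by (auto simp: down_edges_def edges_def)

text \<open>Four families of half-row deviations fail with probability at most
  \<open>3 * real n powr - r\<close> each, and the global linear form with at most
  \<open>2 * real n powr - r\<close>; together these give the factor 14.\<close>

lemma random_edges_walk_pow_bound:
  fixes n :: nat and p q r :: real
  defines "lam \<equiv> (p - q) / (p + q)" and "D \<equiv> real n * (p + q) / 2"
    and "B \<equiv> 4 * exp 4 + 1"
  assumes n: "even n" "n \<ge> 2" and pq: "0 < q" "q < p" "p \<le> 1" and r: "r > 0"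
    and D: "D \<ge> 8" "1024 * (r + 1) * ln (real n) \<le> D"
    and tail: "exp (- (real n / (128 * (r + 1)\<^sup>2 * (ln (real n))\<^sup>2))) \<le> real n powr - r"
  shows "measure_pmf.prob (random_edges n p q)
      {E. (\<forall>v<n. weighted_degree n (adj E) v > 0) \<and>
        (\<forall>k. \<bar>(\<Sum>v<n. class_sign n v * (walk n (adj E) ^^ k) (class_sign n) v) - lam ^ k * real n\<bar>
          \<le> real k * ((2 * sqrt (16 * r * real n * D * ln (real n)) + real n
                + real k * (18 * B * real n)) / D))}
      \<ge> 1 - 14 * real n powr - r" (is "measure_pmf.prob ?M ?good \<ge> _")
proof -
  \<comment> \<open>The Chernoff exponent becomes \<open>(r + 1) * ln (real n)\<close>, one power of
    \<open>n\<close> being spent on the union over the rows. The single form bounded by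
    \<open>S\<close> needs only \<open>r * ln (real n)\<close>.\<close>
  define T where "T = sqrt (16 * (r + 1) * D * ln (real n))"
  define S where "S = sqrt (16 * r * real n * D * ln (real n))"
  define Q where "Q = B * (real n * D)"
  have lam: "\<bar>lam\<bar> \<le> 1"
    using pq by (auto simp: lam_def)
  have ln: "ln (real n) > 0"
    using n by simp
  have T2: "T\<^sup>2 = 16 * (r + 1) * D * ln (real n)"
    unfolding T_def using D ln r by (intro real_sqrt_pow2 mult_nonneg_nonneg) auto
  have T0: "T > 0"
    unfolding T_def using D ln r by (intro real_sqrt_gt_zero mult_pos_pos) auto
  have T_le: "T \<le> D / 8"
  \<comment> \<open>The constant 1024 in the hypothesis on \<open>D\<close> is 16 * 64, from the
    square of \<open>T\<close> and that of \<open>D / 8\<close>.\<close>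
  proof (rule power2_le_imp_le)
    have "T\<^sup>2 = 1024 * (r + 1) * ln (real n) * D / 64"
      by (simp add: T2)
    also have "\<dots> \<le> D * D / 64"
      using D by (intro divide_right_mono mult_right_mono) auto
    finally show "T\<^sup>2 \<le> (D / 8)\<^sup>2" by (simp add: power2_eq_square)
  qed (use D in simp)
  have S2: "S\<^sup>2 = 16 * r * real n * D * ln (real n)"
    unfolding S_def using D ln r by (intro real_sqrt_pow2 mult_nonneg_nonneg) auto
  have S0: "S \<ge> 0"
    unfolding S_def using D ln r by simp
  \<comment> \<open>The range condition of \<open>bernoulli_sum_tail\<close> with
    \<open>V = real n * D\<close>.\<close>
  have S_le: "S \<le> 4 * (real n * D)"
  proof (rule power2_le_imp_le)
    have "r * ln (real n) \<le> 1024 * (r + 1) * ln (real n)"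
      using r ln by (intro mult_right_mono) auto
    then have "r * ln (real n) \<le> real n * D"
      using D n mult_right_mono[of 1 "real n" D] by linarith
    then have "16 * (real n * D) * (r * ln (real n)) \<le> 16 * (real n * D) * (real n * D)"
      using D by (intro mult_left_mono) auto
    then show "S\<^sup>2 \<le> (4 * (real n * D))\<^sup>2"
      unfolding S2 by (simp add: power2_eq_square mult_ac)
  qed (use D in simp)
  have B: "B \<ge> 1"
    by (simp add: B_def)
  have Q: "real n \<le> Q"
    using mult_mono[of 1 B "real n * 1" "real n * D"] mult_left_mono[of 1 D "real n"] B D
    by (simp add: Q_def)
  define bad where "bad = (\<lambda>c F. {E. (\<exists>v<n. \<bar>deviation n p q c (F v) E\<bar> \<ge> T)
      \<or> (\<Sum>v<n. (deviation n p q c (F v) E)\<^sup>2) \<ge> Q})"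
  define badS where "badS = {E. \<bar>deviation n p q (pair_coeff n lam) (edges n) E\<bar> \<ge> S}"
  have expT: "exp (- (T\<^sup>2 / (16 * D))) = real n powr - (r + 1)"
  proof -
    have "T\<^sup>2 / (16 * D) = (r + 1) * ln (real n)"
      using D by (simp add: T2)
    then show ?thesis using n by (simp add: powr_def left_diff_distrib distrib_right)
  qed
  have bad_prob: "measure_pmf.prob ?M (bad c F) \<le> 3 * real n powr - r"
    if c: "\<And>e. \<bar>c e\<bar> \<le> 2" and F: "\<And>v. v < n \<Longrightarrow> F v \<subseteq> edges n" "disjoint_family_on F {..<n}"
      and V: "\<And>v. v < n \<Longrightarrow> (\<Sum>e\<in>F v. edge_prob n p q e) \<le> D" for c F
  proof -
    have "measure_pmf.prob ?M (bad c F)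
        \<le> 2 * real n * exp (- (T\<^sup>2 / (16 * D))) + exp (- 2 * (real n * D\<^sup>2 / T ^ 4))"
      unfolding bad_def deviation_def random_edges_def Q_def B_def
      by (rule disjoint_bernoulli_sums)
        (use finite_edges F edge_prob_bounds[OF pq] c V D T0 T_le n in auto)
    also have "2 * real n * exp (- (T\<^sup>2 / (16 * D))) = 2 * real n powr - r"
      unfolding expT using n powr_add[of "real n" 1 "- (r + 1)"] by simp
    \<comment> \<open>\<open>D\<close> cancels, so the Hoeffding term depends on \<open>n\<close>
      and \<open>r\<close> alone and matches the hypothesis \<open>tail\<close>.\<close>
    also have "- 2 * (real n * D\<^sup>2 / T ^ 4) = - (real n / (128 * (r + 1)\<^sup>2 * (ln (real n))\<^sup>2))"
    proof -
      have "T ^ 4 = (T\<^sup>2)\<^sup>2" by simp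
      also have "\<dots> = 256 * (r + 1)\<^sup>2 * D\<^sup>2 * (ln (real n))\<^sup>2"
        unfolding T2 by (simp only: power_mult_distrib) simp
      finally show ?thesis using D by simp
    qed
    finally show ?thesis using tail by simp
  qed
  have badS_prob: "measure_pmf.prob ?M badS \<le> 2 * real n powr - r"
  proof -
    have "(\<Sum>e\<in>edges n. edge_prob n p q e) \<le> (\<Sum>v<n. D)"
      unfolding sum_up_edges_total[symmetric] D_def
      by (intro sum_mono sum_edge_prob_up_le n pq) auto
    then have "measure_pmf.prob ?M badS \<le> 2 * exp (- (S\<^sup>2 / (16 * (real n * D))))"
      unfolding badS_def deviation_def random_edges_def using n D S0 S_le abs_coeff_le[OF lam]
      by (intro bernoulli_sum_tail finite_edges edge_prob_bounds[OF pq]) auto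
    also have "S\<^sup>2 / (16 * (real n * D)) = r * ln (real n)"
      using n D by (simp add: S2)
    finally show ?thesis using n by (simp add: powr_def)
  qed
  have "- ?good \<subseteq> bad (\<lambda>_. 1) (up_edges n) \<union> bad (\<lambda>_. 1) down_edges
      \<union> bad (up_coeff n lam) (up_edges n) \<union> bad (down_coeff n lam) down_edges \<union> badS"
    (is "_ \<subseteq> ?bad")
  proof
    fix E assume E: "E \<in> - ?good"
    show "E \<in> ?bad"
    proof (rule ccontr)
      assume "E \<notin> ?bad"
      then have nb: "E \<notin> bad (\<lambda>_. 1) (up_edges n)" "E \<notin> bad (\<lambda>_. 1) down_edges"
        "E \<notin> bad (up_coeff n lam) (up_edges n)" "E \<notin> bad (down_coeff n lam) down_edges" "E \<notin> badS"
        by auto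
      have QD: "18 * Q / D = 18 * B * real n"
        using D by (simp add: Q_def)
      have n0: "n > 0" using n by simp
      note bound = walk_pow_class_sign_bound[OF n(1) n0 pq D(1)[unfolded D_def] T_le[unfolded D_def], of E Q S,
          folded D_def lam_def, unfolded QD]
      have "E \<in> ?good"
        unfolding S_def[symmetric]
      proof (intro CollectI conjI)
        show "\<forall>v<n. weighted_degree n (adj E) v > 0"
          by (rule bound(1)) (use nb Q in \<open>auto simp: not_le less_imp_le bad_def badS_def\<close>)
        show "\<forall>k. \<bar>(\<Sum>v<n. class_sign n v * (walk n (adj E) ^^ k) (class_sign n) v) - lam ^ k * real n\<bar>
          \<le> real k * ((2 * S + real n + real k * (18 * B * real n)) / D)"
          by (intro allI, rule bound(2)) (use nb Q in \<open>auto simp: not_le less_imp_le bad_def badS_def\<close>)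
      qed
      with ComplD[OF E] show False by contradiction
    qed
  qed
  then have "measure_pmf.prob ?M (- ?good) \<le> measure_pmf.prob ?M ?bad"
    by (intro measure_pmf.finite_measure_mono) auto
  also have "\<dots> \<le> measure_pmf.prob ?M (bad (\<lambda>_. 1) (up_edges n))
      + measure_pmf.prob ?M (bad (\<lambda>_. 1) down_edges)
      + measure_pmf.prob ?M (bad (up_coeff n lam) (up_edges n))
      + measure_pmf.prob ?M (bad (down_coeff n lam) down_edges) + measure_pmf.prob ?M badS"
    by (intro order_trans[OF measure_Un_le] add_mono order_refl) auto
  also have "\<dots> \<le> 3 * real n powr - r + 3 * real n powr - r + 3 * real n powr - r + 3 * real n powr - r
      + 2 * real n powr - r"
    using sum_edge_prob_up_le[OF n(1) pq(1,2)] sum_edge_prob_down_le[OF n(1) pq(1,2)]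
      abs_coeff_le[OF lam]
    by (intro add_mono bad_prob badS_prob up_edges_subset down_edges_subset disjoint_up_edges
        disjoint_down_edges) (auto simp: D_def)
  finally have "measure_pmf.prob ?M (- ?good) \<le> 14 * real n powr - r"
    by simp
  moreover have "measure_pmf.prob ?M (- ?good) = 1 - measure_pmf.prob ?M ?good"
    using measure_pmf.prob_compl[of ?good ?M] by (simp only: Compl_eq_Diff_UNIV space_measure_pmf sets_measure_pmf UNIV_I)
  ultimately show ?thesis
    by linarith
qed

subsection \<open>Asymptotics\<close>

text \<open>The event is a rectangle with the whole feature space as its second side, and the
  features have total mass 1.\<close>

lemma prob_csbm_graph:
  assumes \<sigma>: "\<sigma> > 0"
  shows "\<P>((A, X) in csbm n p q \<mu>1 \<mu>2 \<sigma>. Q A)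
    = measure_pmf.prob (random_edges n p q) {E. Q (adjacency n E)}"
proof -
  let ?F = "csbm_features n \<mu>1 \<mu>2 \<sigma>"
  interpret F: prob_space ?F
    unfolding csbm_features_def by (intro prob_space_PiM prob_space_normal_density \<sigma>)
  have "\<P>((A, X) in csbm n p q \<mu>1 \<mu>2 \<sigma>. Q A)
      = measure (csbm n p q \<mu>1 \<mu>2 \<sigma>) ({A. Q A} \<times> space ?F)"
    by (intro arg_cong[of _ _ "measure _"]) (auto simp: csbm_def space_pair_measure)
  also have "measure (csbm n p q \<mu>1 \<mu>2 \<sigma>) ({A. Q A} \<times> space ?F)
      = measure_pmf.prob (sbm n p q) {A. Q A}"
    unfolding csbm_def measure_def
    by (subst F.emeasure_pair_measure_Times) (simp_all add: F.emeasure_space_1)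
  also have "\<dots> = measure_pmf.prob (random_edges n p q) {E. Q (adjacency n E)}"
    by (simp add: sbm_eq vimage_def)
  finally show ?thesis .
qed

text \<open>After division by \<open>n\<close>, the fluctuation is of order sqrt (ln n / n) / sqrt D
  and the remaining terms of order 1 / D. Both are o(1 / sqrt D), so the hypothesis
  \<open>small\<close> can absorb \<delta>, \<open>K\<close> and \<open>B\<close>.\<close>

lemma walk_error_bound:
  fixes n k K :: nat and D r B \<delta> Z e :: real
  assumes n: "n > 0" and D: "D > 0" and r: "r > 0" and B: "B \<ge> 0" and \<delta>: "\<delta> > 0" and k: "k \<le> K"
    and Z: "\<bar>Z - e * real n\<bar> \<le> real k * ((2 * sqrt (16 * r * real n * D * ln (real n)) + real n
                + real k * (18 * B * real n)) / D)"
    and small: "\<delta> * real K * (8 * sqrt (r * (ln (real n) / real n)) + (1 + 18 * real K * B) / sqrt D)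
      \<le> 1 / sqrt 2"
  shows "\<bar>\<delta> / real n * Z - e * \<delta>\<bar> \<le> 1 / sqrt (2 * D)"
proof -
  let ?L = "sqrt (r * (ln (real n) / real n))"
  have ln: "ln (real n) \<ge> 0" using n by simp
  have "16 * r * real n * D * ln (real n) = (4 * real n * sqrt D * ?L)\<^sup>2"
    using n D r ln by (simp add: power_mult_distrib power2_eq_square[of "real n"])
  then have S: "sqrt (16 * r * real n * D * ln (real n)) = 4 * real n * sqrt D * ?L"
    using n D r ln by (simp add: real_sqrt_abs)
  have "\<bar>\<delta> / real n * Z - e * \<delta>\<bar> = \<delta> / real n * \<bar>Z - e * real n\<bar>"
  proof -
    have "\<delta> / real n * Z - e * \<delta> = \<delta> / real n * (Z - e * real n)"
      using n by (simp add: field_simps)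
    then show ?thesis using \<delta> n by (simp add: abs_mult)
  qed
  also have "\<dots> \<le> \<delta> / real n * (real K * ((2 * (4 * real n * sqrt D * ?L) + real n
                + real K * (18 * B * real n)) / D))"
  proof (intro mult_left_mono order_trans[OF Z[unfolded S]])
    show "real k * ((2 * (4 * real n * sqrt D * ?L) + real n + real k * (18 * B * real n)) / D)
      \<le> real K * ((2 * (4 * real n * sqrt D * ?L) + real n + real K * (18 * B * real n)) / D)"
      using k n D r B ln
      by (intro mult_mono divide_right_mono add_mono mult_right_mono add_nonneg_nonneg
          divide_nonneg_nonneg mult_nonneg_nonneg) auto
  qed (use \<delta> in simp)
  also have "\<dots> = \<delta> * real K * (8 * sqrt D * ?L + (1 + 18 * real K * B)) / D"
  proof -
    have "2 * (4 * real n * sqrt D * ?L) + real n + real K * (18 * B * real n)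
        = real n * (8 * sqrt D * ?L + (1 + 18 * real K * B))"
      by (simp add: algebra_simps)
    then show ?thesis using n by simp
  qed
  also have "\<dots> = \<delta> * real K * (8 * ?L + (1 + 18 * real K * B) / sqrt D) / sqrt D"
  proof -
    define R where "R = sqrt D"
    have "D = R * R" "R > 0" using D by (auto simp: R_def)
    then show ?thesis unfolding R_def[symmetric] by (simp add: field_simps)
  qed
  also have "\<dots> \<le> (1 / sqrt 2) / sqrt D"
    using small D by (intro divide_right_mono) auto
  finally show ?thesis by (simp add: real_sqrt_mult)
qed

lemma eventually_exp_le_powr:
  fixes c r :: real
  assumes "c > 0" "r > 0"
  shows "eventually (\<lambda>n::nat. exp (- (real n / (c * (ln (real n))\<^sup>2))) \<le> real n powr - r) sequentially"
  using assms by real_asymp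

theorem theorem1:
  fixes K :: nat and r :: real
  assumes "r > 0"
  shows "\<exists>C::real. \<forall>(p :: nat \<Rightarrow> real) (q :: nat \<Rightarrow> real) (\<mu>1::real) (\<mu>2::real) (\<sigma>::real).
    \<mu>1 < \<mu>2 \<longrightarrow> \<sigma> > 0 \<longrightarrow>
    (\<forall>N. 0 < q N \<and> q N < p N \<and> p N \<le> 1) \<longrightarrow>
    p \<in> \<omega>(\<lambda>N. ln (real N) / real N) \<longrightarrow>
    q \<in> \<omega>(\<lambda>N. ln (real N) / real N) \<longrightarrow>
    (\<exists>g \<in> O(\<lambda>N. 1 / real N powr r). \<forall>N. N > 0 \<longrightarrow> even N \<longrightarrow>
      \<P>((A, X) in csbm N (p N) (q N) \<mu>1 \<mu>2 \<sigma>.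
        \<forall>k\<in>{1..K}.
          \<bar>(class_mean (class2 N) A k (node_mean N \<mu>1 \<mu>2)
              - class_mean (class1 N) A k (node_mean N \<mu>1 \<mu>2))
            - ((p N - q N) / (p N + q N)) ^ k * (\<mu>2 - \<mu>1)\<bar>
          \<le> C / sqrt (real N * (p N + q N)))
      \<ge> 1 - g N)"
\<comment> \<open>The constant 1 suffices because the error is of smaller order than the bound; the
  \<open>N\<close> that are too small for this are left to \<open>g\<close>.\<close>
proof (intro exI[of _ 1] allI impI)
  fix p q :: "nat \<Rightarrow> real" and \<mu>1 \<mu>2 \<sigma> :: real
  assume \<mu>: "\<mu>1 < \<mu>2" and \<sigma>: "\<sigma> > 0" and pq: "\<forall>N. 0 < q N \<and> q N < p N \<and> p N \<le> 1"
    and p: "p \<in> \<omega>(\<lambda>N. ln (real N) / real N)"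
  define \<delta> where "\<delta> = \<mu>2 - \<mu>1"
  define B :: real where "B = 4 * exp 4 + 1"
  define D where "D = (\<lambda>N. real N * (p N + q N) / 2)"
  define lam where "lam = (\<lambda>N. (p N - q N) / (p N + q N))"
  define close where "close = (\<lambda>N A. \<forall>k\<in>{1..K}.
    \<bar>(class_mean (class2 N) A k (node_mean N \<mu>1 \<mu>2) - class_mean (class1 N) A k (node_mean N \<mu>1 \<mu>2))
      - lam N ^ k * \<delta>\<bar> \<le> 1 / sqrt (real N * (p N + q N)))"
  define fail where "fail = (\<lambda>N. 1 - measure_pmf.prob (random_edges N (p N) (q N))
    {E. close N (adjacency N E)})"
  \<comment> \<open>Taking the exact failure probability makes the inequality hold at every even
    \<open>N > 0\<close>; only its order of growth remains to be shown, and that concerns large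
    \<open>N\<close> alone.\<close>
  define g where "g = (\<lambda>N. if N > 0 \<and> even N then fail N else 0)"

  have D_ge: "eventually (\<lambda>N. c * ln (real N) \<le> D N) sequentially" if c: "c > 0" for c
  proof -
    have "eventually (\<lambda>N. norm (p N) \<ge> (2 * c) * norm (ln (real N) / real N)) sequentially"
      using c by (intro landau_omega.smallD[OF p]) auto
    then show ?thesis
      using eventually_gt_at_top[of "0::nat"]
    proof eventually_elim
      case (elim N)
      have "2 * c * (ln (real N) / real N) \<le> p N"
        using elim pq[rule_format, of N] by auto
      then have "2 * c * ln (real N) \<le> real N * p N"
        using elim by (simp add: field_simps)
      also have "\<dots> \<le> real N * (p N + q N)"
        using pq[rule_format, of N] by (intro mult_left_mono) auto
      finally show ?case by (simp add: D_def)
    qed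
  qed
  have D_top: "filterlim D at_top sequentially"
  proof (rule filterlim_at_top_mono)
    show "filterlim (\<lambda>N::nat. ln (real N)) at_top sequentially" by real_asymp
    show "eventually (\<lambda>N. ln (real N) \<le> D N) sequentially" using D_ge[of 1] by simp
  qed
  \<comment> \<open>For fixed \<delta> and \<open>K\<close> the relative error tends to 0, since ln
    N / N vanishes and \<open>D\<close> diverges; hence it is eventually below 1 / sqrt 2.\<close>
  have "((\<lambda>N. \<delta> * real K * (8 * sqrt (r * (ln (real N) / real N)) + (1 + 18 * real K * B) / sqrt (D N)))
      \<longlongrightarrow> \<delta> * real K * (8 * sqrt (r * 0) + 0)) sequentially"
  proof (intro tendsto_mult_left tendsto_add tendsto_real_sqrt)
    show "((\<lambda>N::nat. ln (real N) / real N) \<longlongrightarrow> 0) sequentially" by real_asymp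
    show "((\<lambda>N. (1 + 18 * real K * B) / sqrt (D N)) \<longlongrightarrow> 0) sequentially"
      by (intro tendsto_divide_0[OF tendsto_const] filterlim_at_top_imp_at_infinity
          filterlim_compose[OF sqrt_at_top D_top])
  qed
  then have small: "eventually (\<lambda>N. \<delta> * real K * (8 * sqrt (r * (ln (real N) / real N))
      + (1 + 18 * real K * B) / sqrt (D N)) < 1 / sqrt 2) sequentially"
    by (rule order_tendstoD) simp
  have tail: "eventually (\<lambda>N::nat. exp (- (real N / ((128 * (r + 1)\<^sup>2) * (ln (real N))\<^sup>2)))
      \<le> real N powr - r) sequentially"
    using \<open>r > 0\<close> by (intro eventually_exp_le_powr) auto
  have D_ln: "eventually (\<lambda>N. 1024 * (r + 1) * ln (real N) \<le> D N) sequentially"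
    using \<open>r > 0\<close> by (intro D_ge) simp
  have D_8: "eventually (\<lambda>N. 8 \<le> D N) sequentially"
    using D_top by (simp add: filterlim_at_top)
  have "eventually (\<lambda>N. norm (g N) \<le> 14 * norm (1 / real N powr r)) sequentially"
    using small tail D_ln D_8 eventually_ge_at_top[of 2]
  proof eventually_elim
    case (elim N)
    show ?case
    proof (cases "even N")
      case True
      have pqN: "0 < q N" "q N < p N" "p N \<le> 1" using pq by auto
      let ?good = "{E. (\<forall>v<N. weighted_degree N (adj E) v > 0) \<and>
        (\<forall>k. \<bar>(\<Sum>v<N. class_sign N v * (walk N (adj E) ^^ k) (class_sign N) v) - lam N ^ k * real N\<bar>
          \<le> real k * ((2 * sqrt (16 * r * real N * D N * ln (real N)) + real N
                + real k * (18 * B * real N)) / D N))}"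
      have "1 - 14 * real N powr - r \<le> measure_pmf.prob (random_edges N (p N) (q N)) ?good"
        unfolding lam_def D_def B_def using elim \<open>r > 0\<close> True pqN
        by (intro random_edges_walk_pow_bound) (auto simp: D_def)
      also have "\<dots> \<le> measure_pmf.prob (random_edges N (p N) (q N)) {E. close N (adjacency N E)}"
      proof (intro measure_pmf.finite_measure_mono subsetI CollectI)
        fix E assume E: "E \<in> ?good"
        have A: "adjacency N E \<in> carrier_mat N N"
          by (simp add: adjacency_def)
        have a: "adjacency N E $$ (v, w) = adj E v w" if "v < N" "w < N" for v w
          using that by (simp add: adjacency_def adj_def)
        have "\<bar>\<delta> / real N * (\<Sum>v<N. class_sign N v * (walk N (adj E) ^^ k) (class_sign N) v)
            - lam N ^ k * \<delta>\<bar> \<le> 1 / sqrt (2 * D N)" if "k \<in> {1..K}" for k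
          using that E elim \<open>r > 0\<close> \<mu>
          by (intro walk_error_bound[where r = r and B = B and K = K and k = k])
            (auto simp: \<delta>_def B_def add_nonneg_nonneg)
        moreover have "N > 0" using elim by simp
        ultimately show "close N (adjacency N E)"
          unfolding close_def using E class_mean_difference[where a = "adj E", OF True _ A a]
          by (simp add: D_def \<delta>_def)
      qed simp
      finally have "fail N \<le> 14 * real N powr - r"
        by (simp add: fail_def)
      moreover have "fail N \<ge> 0"
        by (simp add: fail_def)
      ultimately show ?thesis
        by (simp add: g_def powr_minus divide_inverse)
    qed (simp add: g_def)
  qed
  then have "g \<in> O(\<lambda>N. 1 / real N powr r)"
    by (rule bigoI)
  moreover have "\<P>((A, X) in csbm N (p N) (q N) \<mu>1 \<mu>2 \<sigma>. close N A) \<ge> 1 - g N"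
    if "N > 0" "even N" for N
    using that by (simp add: prob_csbm_graph[OF \<sigma>] g_def fail_def)
  ultimately show "\<exists>g \<in> O(\<lambda>N. 1 / real N powr r). \<forall>N. N > 0 \<longrightarrow> even N \<longrightarrow>
      \<P>((A, X) in csbm N (p N) (q N) \<mu>1 \<mu>2 \<sigma>.
        \<forall>k\<in>{1..K}.
          \<bar>(class_mean (class2 N) A k (node_mean N \<mu>1 \<mu>2)
              - class_mean (class1 N) A k (node_mean N \<mu>1 \<mu>2))
            - ((p N - q N) / (p N + q N)) ^ k * (\<mu>2 - \<mu>1)\<bar>
          \<le> 1 / sqrt (real N * (p N + q N)))
      \<ge> 1 - g N"
    unfolding close_def lam_def \<delta>_def by blast
qed

end
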